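(* Let $F=\{f_1,\dots,f_m\}$ be a system of polynomials in $n$ variables with real coefficients such that $V(F)\subseteq\mathbb{C}^n$ is smooth and equidimensional of codimension $c$. Let $k\ge 2$ and let $D_k:B_k(F)\to\mathbb{C}$ be defined by $$(x_1,\dots,x_k,t_1,\dots,t_k)\mapsto\frac1k\sum_{i=1}^k d\bigl(x_i,\rho_k(x_1,\dots,x_k,t_1,\dots,t_k)\bigr)^2 .$$ Then $D_k$ is constant on every connected component of $B_k(F)\setminus\Gamma_k$.
   Context: $V(F)=\{x\in\mathbb{C}^n:F(x)=0\}$; $JF(p)$ is the Jacobian matrix of $F$ at $p$. "Smooth of codimension $c$" is understood with respect to the defining equations: $\operatorname{rank} JF(x)=c$ for all $x\in V(F)$. For $x,z\in\mathbb{C}^n$, $d(x,z)^2=\sum_{i}(x_i-z_i)^2$ (no complex conjugation). $\rho_k:(\mathbb{C}^n)^k\times\mathbb{C}^k\to\mathbb{C}^n$ is $\rho_k(x_1,\dots,x_k,t_1,\dots,t_k)=\sum_{i=1}^k t_ix_i$. The $k$-th bottleneck correspondence $B_k(F)\subseteq(\mathbb{C}^n)^k\times\mathbb{C}^k$ is the set of $(x_1,\dots,x_k,t_1,\dots,t_k)$ such that $\sum_{i=1}^k t_i=1$ and, with $z=\sum_{i=1}^k t_ix_i$: $d(x_1,z)^2=d(x_j,z)^2$ for $j=2,\dots,k$; and $F(x_i)=0$ and $\operatorname{rank}[\,x_i-z\ \ JF(x_i)^T]\le c$ for $i=1,\dots,k$. $\Gamma_k\subset(\mathbb{C}^n)^k\times\mathbb{C}^k$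 consists of all points $(x_1,\dots,x_k,t_1,\dots,t_k)$ where some $t_i=0$ or $\{x_1,\dots,x_k\}$ is affinely dependent. *)

theory Defs
  imports "HOL-Analysis.Analysis" "HOL-Library.Poly_Mapping" "HOL-Library.Extended_Nat"
begin

text \<open>
  Polynomials in the variables \<^typ>\<open>'n\<close> are finitely supported maps from exponent vectors to
  coefficients; this type carries the ring structure of the polynomial ring.
\<close>

type_synonym 'n cpoly = "('n \<Rightarrow>\<^sub>0 nat) \<Rightarrow>\<^sub>0 complex"

definition peval :: "'n::finite cpoly \<Rightarrow> complex^'n \<Rightarrow> complex" where
  "peval p x = (\<Sum>e\<in>Poly_Mapping.keys p. Poly_Mapping.lookup p e * (\<Prod>i\<in>UNIV. (x $ i) ^ Poly_Mapping.lookup e i))"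

definition real_coeffs :: "'n cpoly \<Rightarrow> bool" where
  "real_coeffs p \<longleftrightarrow> (\<forall>e. Poly_Mapping.lookup p e \<in> \<real>)"

definition zero_set :: "'n::finite cpoly set \<Rightarrow> (complex^'n) set" where
  "zero_set S = {x. \<forall>p\<in>S. peval p x = 0}"

text \<open>Dimension of algebraic sets: Krull dimension in the Zariski topology.\<close>

definition zariski_closed :: "(complex^'n::finite) set \<Rightarrow> bool" where
  "zariski_closed X \<longleftrightarrow> (\<exists>S. X = zero_set S)"

definition irreducible_closed :: "(complex^'n::finite) set \<Rightarrow> bool" where
  "irreducible_closed X \<longleftrightarrow> zariski_closed X \<and> X \<noteq> {} \<and>
     (\<forall>A B. zariski_closed A \<and> zariski_closed B \<and> X \<subseteq> A \<union> B \<longrightarrow> X \<subseteq> A \<or> X \<subseteq> B)"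

definition irreducible_components :: "(complex^'n::finite) set \<Rightarrow> (complex^'n) set set" where
  "irreducible_components X = {Z. irreducible_closed Z \<and> Z \<subseteq> X \<and>
     (\<forall>W. irreducible_closed W \<and> Z \<subseteq> W \<and> W \<subseteq> X \<longrightarrow> W = Z)}"

text \<open>The supremum of the lengths \<open>d\<close> of chains \<open>Z 0 \<subset> \<dots> \<subset> Z d\<close> of irreducible closed subsets.\<close>

definition krull_dim :: "(complex^'n::finite) set \<Rightarrow> enat" where
  "krull_dim X = Sup {enat d | d. \<exists>Z. (\<forall>i\<le>d. irreducible_closed (Z i) \<and> Z i \<subseteq> X) \<and>
     (\<forall>i<d. Z i \<subset> Z (Suc i))}"

definition equidimensional_codim :: "(complex^'n::finite) set \<Rightarrow> nat \<Rightarrow> bool" where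
  "equidimensional_codim X c \<longleftrightarrow>
     (\<forall>Z\<in>irreducible_components X. krull_dim Z + enat c = enat CARD('n))"

definition jacobian_matrix :: "('m \<Rightarrow> 'n cpoly) \<Rightarrow> complex^'n \<Rightarrow> complex^'n::finite^'m::finite" where
  "jacobian_matrix F p = (\<chi> l j. deriv (\<lambda>w. peval (F l) (\<chi> i. if i = j then w else p $ i)) (p $ j))"

text \<open>
  Smoothness refers to the defining equations, not only to the set they cut out.
\<close>

definition smooth_of_codim :: "('m::finite \<Rightarrow> 'n::finite cpoly) \<Rightarrow> nat \<Rightarrow> bool" where
  "smooth_of_codim F c \<longleftrightarrow> (\<forall>x\<in>zero_set (range F). rank (jacobian_matrix F x) = c)"

text \<open>Bilinear, not Hermitian: no complex conjugation.\<close>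

definition sqdist :: "complex^'n::finite \<Rightarrow> complex^'n \<Rightarrow> complex" where
  "sqdist x z = (\<Sum>i\<in>UNIV. (x $ i - z $ i)\<^sup>2)"

definition rho :: "complex^'n::finite^'k::finite \<Rightarrow> complex^'k \<Rightarrow> complex^'n" where
  "rho x t = (\<Sum>i\<in>UNIV. t $ i *s x $ i)"

text \<open>
  The matrix whose columns are \<open>v\<close> (index \<^const>\<open>None\<close>) followed by the columns of \<open>M\<close>.
\<close>

definition prepend_col :: "complex^'n \<Rightarrow> complex^'m^'n \<Rightarrow> complex^('m option)^'n" where
  "prepend_col v M = (\<chi> i j. case j of None \<Rightarrow> v $ i | Some l \<Rightarrow> M $ i $ l)"

text \<open>
  The points \<open>x\<^sub>1, \<dots>, x\<^sub>k\<close> are indexed by the type \<^typ>\<open>'k\<close>, which has no distinguished first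
  element; that all squared distances equal the first one is therefore written as equality for
  all pairs of indices.
\<close>

definition bottleneck ::
  "('m::finite \<Rightarrow> 'n::finite cpoly) \<Rightarrow> nat \<Rightarrow> (((complex^'n)^'k::finite) \<times> (complex^'k)) set" where
  "bottleneck F c = {(x, t). (\<Sum>i\<in>UNIV. t $ i) = 1 \<and>
     (\<forall>i j. sqdist (x $ i) (rho x t) = sqdist (x $ j) (rho x t)) \<and>
     (\<forall>i. x $ i \<in> zero_set (range F) \<and>
        rank (prepend_col (x $ i - rho x t) (transpose (jacobian_matrix F (x $ i)))) \<le> c)}"

text \<open>
  Affine dependence over the complex numbers, of the tuple: a repeated point makes it dependent.
  (The library's \<^const>\<open>affine_dependent\<close> is over the reals and about sets.)
\<close>

definition affinely_dependent :: "complex^'n::finite^'k::finite \<Rightarrow> bool" where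
  "affinely_dependent x \<longleftrightarrow> (\<exists>a :: complex^'k. a \<noteq> 0 \<and> (\<Sum>i\<in>UNIV. a $ i) = 0 \<and>
     (\<Sum>i\<in>UNIV. a $ i *s x $ i) = 0)"

definition Gam :: "(((complex^'n::finite)^'k::finite) \<times> (complex^'k)) set" where
  "Gam = {(x, t). (\<exists>i. t $ i = 0) \<or> affinely_dependent x}"

definition D :: "((complex^'n::finite)^'k::finite) \<times> (complex^'k) \<Rightarrow> complex" where
  "D = (\<lambda>(x, t). (1 / of_nat CARD('k)) * (\<Sum>i\<in>UNIV. sqdist (x $ i) (rho x t)))"

end

theory Submission
  imports Defs "HOL-Library.Function_Algebras"
begin

text \<open>
  Since the \<open>t\<^sub>i\<close> sum to \<open>1\<close> and all the \<open>d(x\<^sub>i, z)\<^sup>2\<close> agree, \<open>D\<close> coincides on the bottleneck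
  correspondence with the polynomial \<open>\<Sum>\<^sub>i t\<^sub>i d(x\<^sub>i, z)\<^sup>2\<close>. This polynomial has better derivatives
  than \<open>D\<close>: for a tangent direction \<open>(dx, dt)\<close> its differential is
  \<open>\<Sum>\<^sub>i dt\<^sub>i d(x\<^sub>i, z)\<^sup>2 + 2 \<Sum>\<^sub>i t\<^sub>i (x\<^sub>i - z) \<bullet> dx\<^sub>i - 2 (\<Sum>\<^sub>i t\<^sub>i (x\<^sub>i - z)) \<bullet> dz\<close>.
  The first sum is a multiple of \<open>\<Sum>\<^sub>i dt\<^sub>i = 0\<close>; the last vanishes because \<open>z = \<Sum>\<^sub>i t\<^sub>i x\<^sub>i\<close>; and the
  middle one vanishes because the rank condition, together with \<open>rank JF(x\<^sub>i) = c\<close>, puts \<open>x\<^sub>i - z\<close>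
  into the row space of \<open>JF(x\<^sub>i)\<close>, which is orthogonal to every \<open>dx\<^sub>i\<close> tangent to \<open>V(F)\<close>. So the
  differential is a combination of differentials of polynomials that vanish on the correspondence
  (\<open>weighted_sqdist_critical\<close>).

  The rest is an algebraic Sard theorem, \<open>countable_critical_values\<close>: if \<open>A\<close> is a subset of affine
  space and, at every point of \<open>A\<close>, the differential of a polynomial \<open>f\<close> kills all vectors killed by
  the differentials of the ideal \<open>I(A)\<close> of polynomials vanishing on \<open>A\<close>, then \<open>f(A)\<close> is countable.
  A connected countable set of complex numbers has at most one element, which gives the theorem.

  The Sard theorem is proved by Noetherian induction on \<open>I(A)\<close>. Among the systems \<open>G\<close> of \<open>N\<close>
  polynomials (\<open>N\<close> is the dimension of the ambient space) whose Jacobian determinant \<open>\<Delta>\<close> is not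
  identically zero on \<open>A\<close>, one with as many members in \<open>I(A)\<close> as possible is chosen. The points of
  \<open>A\<close> with \<open>\<Delta> = 0\<close> have a larger ideal, so the induction hypothesis covers them. Near a point
  \<open>p\<close> with \<open>\<Delta>(p) \<noteq> 0\<close> the system \<open>G\<close> is a coordinate system, and \<open>f\<close> turns out to be constant on \<open>A\<close>
  near \<open>p\<close> (\<open>locally_constant\<close>): connect \<open>p\<close> to a nearby point of \<open>A\<close> by a straight line in these
  coordinates. By Cramer's rule the derivative of a polynomial \<open>h\<close> along that path is
  \<open>\<Delta>\<inverse> \<Sum>\<^sub>k M\<^sub>k(h) a\<^sub>k\<close>, where \<open>M\<^sub>k(h)\<close> is the determinant obtained from \<open>\<Delta>\<close> by replacing the row of
  \<open>G\<^sub>k\<close> by \<open>dh\<close>, and the constants \<open>a\<^sub>k\<close> vanish whenever \<open>G\<^sub>k \<in> I(A)\<close>. For \<open>h \<in> I(A)\<close> and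
  \<open>G\<^sub>k \<notin> I(A)\<close>, the maximality of \<open>G\<close> gives \<open>M\<^sub>k(h) \<in> I(A)\<close>. Hence finitely many
  generators of \<open>I(A)\<close>, restricted to the path, solve a homogeneous linear system of differential
  equations with zero initial value, and vanish on the whole path. As \<open>\<Delta> M\<^sub>k(f) \<in> I(A)\<close> by the
  criticality of \<open>f\<close>, also the derivative of \<open>f\<close> along the path is zero.

  Both the induction and the finite generation of \<open>I(A)\<close> come from Hilbert's basis theorem, which
  is proved for subrings \<open>R[x]\<close> of an arbitrary commutative ring so that it applies directly to
  rings of polynomial functions.
\<close>

section \<open>Hilbert's basis theorem for subrings\<close>

definition subring :: "'a::comm_ring_1 set \<Rightarrow> bool" where
  "subring R \<longleftrightarrow> 0 \<in> R \<and> 1 \<in> R \<and> (\<forall>a\<in>R. - a \<in> R) \<and> (\<forall>a\<in>R. \<forall>b\<in>R. a + b \<in> R \<and> a * b \<in> R)"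

definition ideal_of :: "'a::comm_ring_1 set \<Rightarrow> 'a set \<Rightarrow> bool" where
  "ideal_of R I \<longleftrightarrow> I \<subseteq> R \<and> 0 \<in> I \<and> (\<forall>a\<in>I. \<forall>b\<in>I. a + b \<in> I) \<and> (\<forall>r\<in>R. \<forall>a\<in>I. r * a \<in> I)"

inductive_set ideal_gen :: "'a::comm_ring_1 set \<Rightarrow> 'a set \<Rightarrow> 'a set" for R S where
  zero: "0 \<in> ideal_gen R S"
| step: "\<lbrakk>r \<in> R; s \<in> S; y \<in> ideal_gen R S\<rbrakk> \<Longrightarrow> r * s + y \<in> ideal_gen R S"

definition noetherian :: "'a::comm_ring_1 set \<Rightarrow> bool" where
  "noetherian R \<longleftrightarrow> (\<forall>I. ideal_of R I \<longrightarrow> (\<exists>T. finite T \<and> T \<subseteq> I \<and> I \<subseteq> ideal_gen R T))"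

lemma subring_0: "subring R \<Longrightarrow> 0 \<in> R"
  and subring_1: "subring R \<Longrightarrow> 1 \<in> R"
  and subring_uminus: "subring R \<Longrightarrow> a \<in> R \<Longrightarrow> - a \<in> R"
  and subring_add: "subring R \<Longrightarrow> a \<in> R \<Longrightarrow> b \<in> R \<Longrightarrow> a + b \<in> R"
  and subring_mult: "subring R \<Longrightarrow> a \<in> R \<Longrightarrow> b \<in> R \<Longrightarrow> a * b \<in> R"
  by (auto simp: subring_def)

lemma ideal_of_sum:
  assumes "ideal_of R I" "\<And>a. a \<in> A \<Longrightarrow> f a \<in> I"
  shows "sum f A \<in> I"
  using assms(2) by (induction A rule: infinite_finite_induct) (use assms(1) in \<open>auto simp: ideal_of_def\<close>)

lemma ideal_gen_minimal:
  assumes "ideal_of R I" "S \<subseteq> I"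
  shows "ideal_gen R S \<subseteq> I"
proof
  fix x assume "x \<in> ideal_gen R S"
  then show "x \<in> I"
    by induction (use assms in \<open>auto simp: ideal_of_def\<close>)
qed

lemma ideal_gen_mono: "S \<subseteq> T \<Longrightarrow> ideal_gen R S \<subseteq> ideal_gen R T"
proof
  fix x assume "S \<subseteq> T" "x \<in> ideal_gen R S"
  from this(2,1) show "x \<in> ideal_gen R T"
    by induction (auto intro: ideal_gen.intros)
qed

lemma ideal_gen_superset: "subring R \<Longrightarrow> S \<subseteq> ideal_gen R S"
  using ideal_gen.step[OF subring_1 _ ideal_gen.zero, of R _ S] by auto

lemma ideal_of_ideal_gen:
  assumes R: "subring R" and S: "S \<subseteq> R"
  shows "ideal_of R (ideal_gen R S)"
proof -
  have "a + b \<in> ideal_gen R S" if "a \<in> ideal_gen R S" "b \<in> ideal_gen R S" for a b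
    using that by (induction a) (auto simp: add.assoc intro: ideal_gen.intros)
  moreover have "r * a \<in> ideal_gen R S" if "r \<in> R" "a \<in> ideal_gen R S" for r a
    using that(2)
  proof induction
    case (step r' s y)
    then have "(r * r') * s + r * y \<in> ideal_gen R S"
      using R that(1) by (intro ideal_gen.step) (auto intro: subring_mult)
    then show ?case by (simp add: algebra_simps)
  qed (auto intro: ideal_gen.intros)
  moreover have "x \<in> R" if "x \<in> ideal_gen R S" for x
    using that by induction (use S in \<open>auto intro: subring_0[OF R] subring_add[OF R] subring_mult[OF R]\<close>)
  ultimately show ?thesis
    by (auto simp: ideal_of_def intro: ideal_gen.intros)
qed

lemma ideal_gen_finite_image:
  assumes R: "subring R" and A: "finite A" and "x \<in> ideal_gen R (h ` A)"
  obtains u where "\<And>i. u i \<in> R" "x = (\<Sum>i\<in>A. u i * h i)"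
proof -
  from assms(3) have "\<exists>u. (\<forall>i. u i \<in> R) \<and> x = (\<Sum>i\<in>A. u i * h i)"
  proof induction
    case zero
    show ?case by (rule exI[of _ "\<lambda>_. 0"]) (simp add: subring_0[OF R])
  next
    case (step r s y)
    then obtain u i where u: "\<forall>i. u i \<in> R" "y = (\<Sum>i\<in>A. u i * h i)" and i: "i \<in> A" "s = h i"
      by auto
    have "r * s + y = (\<Sum>j\<in>A. (u j + (if j = i then r else 0)) * h j)"
      using A i u(2) by (simp add: algebra_simps sum.distrib if_distrib[of "\<lambda>x. _ * x"] cong: if_cong)
    then show ?case
      using u(1) step.hyps(1)
      by (intro exI[of _ "\<lambda>j. u j + (if j = i then r else 0)"]) (auto intro: subring_add[OF R])
  qed
  then show ?thesis using that by blast
qed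

text \<open>
  The ascending chain condition in the form in which it is used below: the ideals generated by the
  initial segments of a sequence cannot grow forever.
\<close>

lemma noetherian_sequence:
  assumes R: "subring R" and noeth: "noetherian R" and h: "\<And>n. h n \<in> R"
  shows "\<exists>n::nat. h n \<in> ideal_gen R (h ` {..<n})"
proof -
  define K where "K n = ideal_gen R (h ` {..<n})" for n
  define I where "I = (\<Union>n. K n)"
  have ideal: "ideal_of R (K n)" for n
    unfolding K_def using h by (intro ideal_of_ideal_gen R) auto
  have mono: "K m \<subseteq> K n" if "m \<le> n" for m n
    unfolding K_def using that by (intro ideal_gen_mono) auto
  have "ideal_of R I"
    unfolding ideal_of_def
  proof (intro conjI ballI)
    fix a b assume "a \<in> I" "b \<in> I"
    then obtain m n where "a \<in> K m" "b \<in> K n" by (auto simp: I_def)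
    then have "a \<in> K (max m n)" "b \<in> K (max m n)"
      using mono[of m "max m n"] mono[of n "max m n"] by auto
    then show "a + b \<in> I" using ideal[of "max m n"] by (auto simp: ideal_of_def I_def)
  next
    fix r a assume "r \<in> R" "a \<in> I"
    then obtain n where "a \<in> K n" by (auto simp: I_def)
    then have "r * a \<in> K n" using ideal[of n] \<open>r \<in> R\<close> by (auto simp: ideal_of_def)
    then show "r * a \<in> I" by (auto simp: I_def)
  qed (use ideal in \<open>unfold ideal_of_def I_def, blast+\<close>)
  then obtain T where T: "finite T" "T \<subseteq> I" "I \<subseteq> ideal_gen R T"
    using noeth by (auto simp: noetherian_def)
  have "\<exists>N. T \<subseteq> K N"
    using T(1,2)
  proof (induction T)
    case (insert t T)
    then obtain N M where "T \<subseteq> K N" "t \<in> K M" by (auto simp: I_def)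
    then have "insert t T \<subseteq> K (max N M)"
      using mono[of N "max N M"] mono[of M "max N M"] by auto
    then show ?case by blast
  qed auto
  then obtain N where "T \<subseteq> K N" by blast
  then have "I \<subseteq> K N" using T(3) ideal_gen_minimal[OF ideal] by blast
  moreover have "h N \<in> I"
    using ideal_gen_superset[OF R, of "h ` {..<Suc N}"] by (auto simp: I_def K_def)
  ultimately show ?thesis by (auto simp: K_def)
qed

text \<open>
  The element \<open>x\<close> may be algebraic over \<open>R\<close>, so an element of \<open>R[x]\<close> has no well-defined degree;
  what makes sense is to have some representation of degree less than \<open>d\<close>.
\<close>

definition low_degree :: "'a::comm_ring_1 set \<Rightarrow> 'a \<Rightarrow> nat \<Rightarrow> 'a set" where
  "low_degree R x d = {p. \<exists>b. (\<forall>k. b k \<in> R) \<and> p = (\<Sum>k<d. b k * x ^ k)}"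

definition adjoin :: "'a::comm_ring_1 set \<Rightarrow> 'a \<Rightarrow> 'a set" where
  "adjoin R x = (\<Union>d. low_degree R x d)"

context
  fixes R :: "'a::comm_ring_1 set" and x :: 'a
  assumes R: "subring R"
begin

lemma low_degree_mono:
  assumes "m \<le> n" shows "low_degree R x m \<subseteq> low_degree R x n"
proof
  fix p assume "p \<in> low_degree R x m"
  then obtain b where b: "\<forall>k. b k \<in> R" "p = (\<Sum>k<m. b k * x ^ k)" by (auto simp: low_degree_def)
  have "p = (\<Sum>k<n. (if k < m then b k else 0) * x ^ k)"
    unfolding b(2) using assms by (intro sum.mono_neutral_cong_left) auto
  then show "p \<in> low_degree R x n"
    using b(1) subring_0[OF R] unfolding low_degree_def by (intro CollectI exI[of _ "\<lambda>k. if k < m then b k else 0"]) auto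
qed

lemma low_degree_0: "0 \<in> low_degree R x d"
  unfolding low_degree_def using subring_0[OF R] by (intro CollectI exI[of _ "\<lambda>_. 0"]) auto

lemma low_degree_add:
  assumes "p \<in> low_degree R x d" "q \<in> low_degree R x d" shows "p + q \<in> low_degree R x d"
proof -
  obtain a b where "\<forall>k. a k \<in> R" "p = (\<Sum>k<d. a k * x ^ k)" "\<forall>k. b k \<in> R" "q = (\<Sum>k<d. b k * x ^ k)"
    using assms by (auto simp: low_degree_def)
  then show ?thesis unfolding low_degree_def
    by (intro CollectI exI[of _ "\<lambda>k. a k + b k"]) (auto simp: algebra_simps sum.distrib intro: subring_add[OF R])
qed

lemma low_degree_scale:
  assumes "r \<in> R" "q \<in> low_degree R x d" shows "r * q \<in> low_degree R x d"
proof -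
  obtain b where "\<forall>k. b k \<in> R" "q = (\<Sum>k<d. b k * x ^ k)"
    using assms by (auto simp: low_degree_def)
  then show ?thesis unfolding low_degree_def
    by (intro CollectI exI[of _ "\<lambda>k. r * b k"])
      (auto simp: algebra_simps sum_distrib_left intro: subring_mult[OF R assms(1)])
qed

lemma low_degree_shift:
  assumes "q \<in> low_degree R x d" shows "x ^ j * q \<in> low_degree R x (d + j)"
proof -
  obtain b where b: "\<forall>k. b k \<in> R" "q = (\<Sum>k<d. b k * x ^ k)"
    using assms by (auto simp: low_degree_def)
  have "x ^ j * q = (\<Sum>k<d. b k * x ^ (k + j))"
    by (simp add: b(2) sum_distrib_left power_add algebra_simps)
  also have "\<dots> = (\<Sum>k\<in>{j..<d+j}. b (k - j) * x ^ k)"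
    by (rule sum.reindex_bij_witness[of _ "\<lambda>k. k - j" "\<lambda>k. k + j"]) auto
  also have "\<dots> = (\<Sum>k<d + j. (if k < j then 0 else b (k - j)) * x ^ k)"
    by (intro sum.mono_neutral_cong_left) auto
  finally show ?thesis
    using b(1) subring_0[OF R] unfolding low_degree_def
    by (intro CollectI exI[of _ "\<lambda>k. if k < j then 0 else b (k - j)"]) auto
qed

lemma low_degree_sum:
  "(\<And>i. i \<in> A \<Longrightarrow> f i \<in> low_degree R x d) \<Longrightarrow> sum f A \<in> low_degree R x d"
  by (induction A rule: infinite_finite_induct) (auto intro: low_degree_0 low_degree_add)

lemma low_degree_mult:
  assumes "p \<in> low_degree R x m" "q \<in> low_degree R x n" shows "p * q \<in> low_degree R x (m + n)"
proof -
  obtain a where a: "\<forall>k. a k \<in> R" "p = (\<Sum>k<m. a k * x ^ k)"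
    using assms by (auto simp: low_degree_def)
  have "p * q = (\<Sum>k<m. a k * (x ^ k * q))"
    by (simp add: a(2) sum_distrib_right mult.assoc)
  moreover have "a k * (x ^ k * q) \<in> low_degree R x (m + n)" if "k < m" for k
    using that low_degree_scale[of "a k" "x ^ k * q" "n + k"] low_degree_shift[OF assms(2), of k] a(1)
      low_degree_mono[of "n + k" "m + n"] by auto
  ultimately show ?thesis by (metis (no_types, lifting) lessThan_iff low_degree_sum)
qed

lemma low_degree_1: "p \<in> low_degree R x 1 \<longleftrightarrow> p \<in> R"
  by (auto simp: low_degree_def)

lemma base_subset_adjoin: "R \<subseteq> adjoin R x"
  using low_degree_1 by (auto simp: adjoin_def)

lemma generator_in_adjoin: "x \<in> adjoin R x"
  using low_degree_shift[of 1 1 1] subring_1[OF R] low_degree_1 by (auto simp: adjoin_def)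

lemma subring_adjoin: "subring (adjoin R x)"
proof -
  have "p + q \<in> adjoin R x" if p: "p \<in> adjoin R x" and q: "q \<in> adjoin R x" for p q
  proof -
    obtain m n where "p \<in> low_degree R x m" "q \<in> low_degree R x n" using p q by (auto simp: adjoin_def)
    then have "p + q \<in> low_degree R x (max m n)"
      using low_degree_mono[of m "max m n"] low_degree_mono[of n "max m n"] by (intro low_degree_add) auto
    then show ?thesis by (auto simp: adjoin_def)
  qed
  moreover have "- p \<in> adjoin R x" if "p \<in> adjoin R x" for p
    using that low_degree_scale[of "- 1" p] subring_uminus[OF R subring_1[OF R]]
    by (auto simp: adjoin_def)
  moreover have "p * q \<in> adjoin R x" if "p \<in> adjoin R x" "q \<in> adjoin R x" for p q
    using that low_degree_mult by (fastforce simp: adjoin_def)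
  ultimately show ?thesis
    using base_subset_adjoin subring_0[OF R] subring_1[OF R] by (auto simp: subring_def)
qed

text \<open>
  Hilbert's argument only uses upper bounds for degrees, hence works for representations in place
  of formal polynomials. If an ideal \<open>I\<close> of \<open>R[x]\<close> is not finitely generated, one picks successively
  elements \<open>f n\<close> of \<open>I\<close> outside the ideal of the previous ones, with a representation of least
  possible degree. Some leading coefficient is an \<open>R\<close>-combination of the earlier ones, and
  subtracting the corresponding combination of the earlier elements lowers the degree.
\<close>

theorem hilbert_basis:
  assumes noeth: "noetherian R"
  shows "noetherian (adjoin R x)"
  unfolding noetherian_def
proof (intro allI impI, rule ccontr)
  let ?P = "adjoin R x"
  fix I assume I: "ideal_of ?P I" and "\<nexists>T. finite T \<and> T \<subseteq> I \<and> I \<subseteq> ideal_gen ?P T"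
  then have not_gen: "\<exists>p. p \<in> I - ideal_gen ?P T" if "finite T" "T \<subseteq> I" for T
    using that by blast
  have gen_ideal: "ideal_of ?P (ideal_gen ?P T)" if "T \<subseteq> I" for T
    using that I by (intro ideal_of_ideal_gen subring_adjoin) (auto simp: ideal_of_def)
  define deg where "deg T = (LEAST d. \<exists>p. p \<in> I - ideal_gen ?P T \<and> p \<in> low_degree R x d)" for T
  have deg_ex: "\<exists>p. p \<in> I - ideal_gen ?P T \<and> p \<in> low_degree R x (deg T)"
    if T: "finite T" "T \<subseteq> I" for T
  proof -
    obtain p where p: "p \<in> I - ideal_gen ?P T" using not_gen[OF T] by blast
    then have "p \<in> ?P" using I by (auto simp: ideal_of_def)
    then obtain d where "p \<in> low_degree R x d" by (auto simp: adjoin_def)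
    then show ?thesis unfolding deg_def
      by (intro LeastI_ex[of "\<lambda>d. \<exists>p. p \<in> I - ideal_gen ?P T \<and> p \<in> low_degree R x d"]) (use p in blast)
  qed
  have deg_le: "deg T \<le> d" if "p \<in> I - ideal_gen ?P T" "p \<in> low_degree R x d" for p d T
    unfolding deg_def by (rule Least_le) (use that in blast)
  \<comment> \<open>a sequence in \<open>I\<close> whose members have minimal degree outside the ideal of their predecessors\<close>
  define next_elt where "next_elt T = (SOME p. p \<in> I - ideal_gen ?P T \<and> p \<in> low_degree R x (deg T))" for T
  have next_elt: "next_elt T \<in> I - ideal_gen ?P T \<and> next_elt T \<in> low_degree R x (deg T)"
    if "finite T" "T \<subseteq> I" for T
    unfolding next_elt_def by (rule someI_ex) (rule deg_ex[OF that])
  define E where "E = rec_nat {} (\<lambda>n T. insert (next_elt T) T)"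
  define f where "f n = next_elt (E n)" for n
  have E_Suc: "E (Suc n) = insert (f n) (E n)" for n by (simp add: E_def f_def)
  have E: "finite (E n) \<and> E n \<subseteq> I" for n
  proof (induction n)
    case (Suc n)
    then show ?case using next_elt[of "E n"] by (auto simp: E_Suc f_def)
  qed (simp add: E_def)
  have E_eq: "E n = f ` {..<n}" for n
    by (induction n) (auto simp: E_Suc lessThan_Suc, simp add: E_def)
  define d where "d n = deg (E n)" for n
  have f: "f n \<in> I" "f n \<notin> ideal_gen ?P (E n)" "f n \<in> low_degree R x (d n)" for n
    using next_elt[of "E n"] E[of n] by (auto simp: f_def d_def)
  have d_mono: "d m \<le> d n" if "m \<le> n" for m n
  proof -
    have "ideal_gen ?P (E m) \<subseteq> ideal_gen ?P (E n)"
      using that by (intro ideal_gen_mono) (auto simp: E_eq)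
    then show ?thesis unfolding d_def[of m] using f[of n] by (intro deg_le[of "f n"]) auto
  qed
  have d_pos: "d n > 0" for n
  proof (rule ccontr)
    assume "\<not> d n > 0"
    then have "f n = 0" using f(3)[of n] by (auto simp: low_degree_def)
    then show False using f(2)[of n] ideal_gen.zero[of ?P "E n"] by simp
  qed
  have "\<exists>a r. a \<in> R \<and> r \<in> low_degree R x (d n - 1) \<and> f n = a * x ^ (d n - 1) + r" for n
  proof -
    obtain b where b: "\<forall>k. b k \<in> R" "f n = (\<Sum>k<d n. b k * x ^ k)"
      using f(3) by (auto simp: low_degree_def)
    have "{..<d n} = insert (d n - 1) {..<d n - 1}" using d_pos[of n] by auto
    then have "f n = b (d n - 1) * x ^ (d n - 1) + (\<Sum>k<d n - 1. b k * x ^ k)" by (simp add: b(2))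
    then show ?thesis using b(1) by (auto simp: low_degree_def)
  qed
  then obtain a r where a: "\<And>n. a n \<in> R" and r: "\<And>n. r n \<in> low_degree R x (d n - 1)"
    and fa: "\<And>n. f n = a n * x ^ (d n - 1) + r n" by metis
  obtain n where "a n \<in> ideal_gen R (a ` {..<n})" using noetherian_sequence[of R a, OF R noeth a] by blast
  then obtain u where u: "\<And>i. u i \<in> R" "a n = (\<Sum>i<n. u i * a i)"
    using ideal_gen_finite_image[OF R] by (metis finite_lessThan)
  \<comment> \<open>cancelling the leading coefficient contradicts the minimality of the degree of \<open>f n\<close>\<close>
  define s where "s = (\<Sum>i<n. u i * x ^ (d n - d i) * f i)"
  have sE: "s \<in> ideal_gen ?P (E n)"
    unfolding s_def
  proof (rule ideal_of_sum[OF gen_ideal])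
    fix i assume "i \<in> {..<n}"
    have "x ^ k \<in> ?P" for k
      by (induction k) (auto intro: subring_1[OF subring_adjoin] subring_mult[OF subring_adjoin] generator_in_adjoin)
    then have "u i * x ^ (d n - d i) \<in> ?P"
      using u(1) base_subset_adjoin by (blast intro: subring_mult[OF subring_adjoin])
    moreover have "f i \<in> ideal_gen ?P (E n)"
      using \<open>i \<in> {..<n}\<close> ideal_gen_superset[OF subring_adjoin, of "E n"] unfolding E_eq by blast
    ultimately show "u i * x ^ (d n - d i) * f i \<in> ideal_gen ?P (E n)"
      using gen_ideal[of "E n"] E[of n] by (auto simp: ideal_of_def)
  qed (use E in auto)
  have sI: "s \<in> I" using sE ideal_gen_minimal[OF I, of "E n"] E[of n] by auto
  have m1: "- 1 \<in> ?P" by (intro subring_uminus subring_1 subring_adjoin)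
  have ideal_diff: "p - q \<in> K" if "ideal_of ?P K" "p \<in> K" "q \<in> K" for p q K
  proof -
    have "p + (- 1) * q \<in> K" using that m1 unfolding ideal_of_def by blast
    then show ?thesis by simp
  qed
  have "f n - s \<in> I" by (rule ideal_diff[OF I f(1) sI])
  moreover have "f n - s \<notin> ideal_gen ?P (E n)"
  proof
    assume "f n - s \<in> ideal_gen ?P (E n)"
    then have "(f n - s) + s \<in> ideal_gen ?P (E n)"
      using sE gen_ideal[of "E n"] E[of n] unfolding ideal_of_def by blast
    then show False using f(2)[of n] by simp
  qed
  moreover have "f n - s \<in> low_degree R x (d n - 1)"
  proof -
    have eq: "u i * x ^ (d n - d i) * f i
        = u i * a i * x ^ (d n - 1) + u i * (x ^ (d n - d i) * r i)" if "i < n" for i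
    proof -
      have "x ^ (d n - 1) = x ^ (d n - d i) * x ^ (d i - 1)"
        using d_mono[of i n] d_pos[of i] that by (simp flip: power_add)
      then show ?thesis by (simp add: fa[of i] algebra_simps)
    qed
    have "s = (\<Sum>i<n. u i * a i * x ^ (d n - 1)) + (\<Sum>i<n. u i * (x ^ (d n - d i) * r i))"
      unfolding s_def by (simp add: eq sum.distrib)
    also have "(\<Sum>i<n. u i * a i * x ^ (d n - 1)) = a n * x ^ (d n - 1)"
      by (simp add: u(2) sum_distrib_right)
    finally have "f n - s = r n + (\<Sum>i<n. (- u i) * (x ^ (d n - d i) * r i))"
      by (simp add: fa[of n] sum_negf)
    moreover have "(- u i) * (x ^ (d n - d i) * r i) \<in> low_degree R x (d n - 1)" if "i < n" for i
    proof -
      have "d i - 1 + (d n - d i) = d n - 1" using d_mono[of i n] d_pos[of i] that by simp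
      then have "x ^ (d n - d i) * r i \<in> low_degree R x (d n - 1)"
        using low_degree_shift[OF r[of i], of "d n - d i"] by simp
      then show ?thesis by (rule low_degree_scale[OF subring_uminus[OF R u(1)]])
    qed
    then have "(\<Sum>i<n. (- u i) * (x ^ (d n - d i) * r i)) \<in> low_degree R x (d n - 1)"
      by (intro low_degree_sum) auto
    ultimately show ?thesis using low_degree_add[OF r] by simp
  qed
  ultimately have "d n \<le> d n - 1" unfolding d_def[of n] by (intro deg_le[of "f n - s"]) (auto simp: d_def)
  then show False using d_pos[of n] by simp
qed

end

section \<open>Polynomial functions\<close>

inductive_set polyfun :: "(complex^'n \<Rightarrow> complex) set" where
  const: "(\<lambda>_. c) \<in> polyfun"
| coord: "(\<lambda>q. q $ i) \<in> polyfun"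
| add: "\<lbrakk>f \<in> polyfun; g \<in> polyfun\<rbrakk> \<Longrightarrow> (\<lambda>q. f q + g q) \<in> polyfun"
| mult: "\<lbrakk>f \<in> polyfun; g \<in> polyfun\<rbrakk> \<Longrightarrow> (\<lambda>q. f q * g q) \<in> polyfun"

lemma polyfun_diff: "\<lbrakk>f \<in> polyfun; g \<in> polyfun\<rbrakk> \<Longrightarrow> (\<lambda>q. f q - g q) \<in> polyfun"
  using polyfun.add[OF _ polyfun.mult[OF polyfun.const[of "-1"]]] by simp

lemma polyfun_sum: "(\<And>i. i \<in> A \<Longrightarrow> f i \<in> polyfun) \<Longrightarrow> (\<lambda>q. \<Sum>i\<in>A. f i q) \<in> polyfun"
  by (induction A rule: infinite_finite_induct) (auto intro: polyfun.intros)

lemma polyfun_prod: "(\<And>i. i \<in> A \<Longrightarrow> f i \<in> polyfun) \<Longrightarrow> (\<lambda>q. \<Prod>i\<in>A. f i q) \<in> polyfun"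
  by (induction A rule: infinite_finite_induct) (auto intro: polyfun.intros)

lemma polyfun_power: "f \<in> polyfun \<Longrightarrow> (\<lambda>q. f q ^ k) \<in> polyfun"
  by (induction k) (auto intro: polyfun.intros)

lemma polyfun_det:
  "(\<And>i j. A i j \<in> polyfun) \<Longrightarrow> (\<lambda>q. det (\<chi> i j. A i j q)) \<in> polyfun"
  unfolding det_def by (auto intro!: polyfun_sum polyfun.mult[OF polyfun.const] polyfun_prod)

lemma subring_polyfun: "subring polyfun"
proof -
  have "- f \<in> polyfun" if "f \<in> polyfun" for f :: "complex^'n \<Rightarrow> complex"
    using polyfun.mult[OF polyfun.const[of "-1"] that] by (simp add: fun_Compl_def)
  then show ?thesis
    using polyfun.add polyfun.mult polyfun.const[of 0] polyfun.const[of 1]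
    by (auto simp: subring_def plus_fun_def times_fun_def zero_fun_def one_fun_def)
qed

lemma noetherian_constants: "noetherian (range (\<lambda>c::complex. (\<lambda>_::'a. c)))"
  unfolding noetherian_def
proof (intro allI impI)
  let ?C = "range (\<lambda>c::complex. (\<lambda>_::'a. c))"
  fix I assume I: "ideal_of ?C I"
  show "\<exists>T. finite T \<and> T \<subseteq> I \<and> I \<subseteq> ideal_gen ?C T"
  proof (cases "I \<subseteq> {0}")
    case True
    then show ?thesis by (intro exI[of _ "{}"]) (auto intro: ideal_gen.zero)
  next
    case False
    then obtain c where c: "(\<lambda>_. c) \<in> I" "c \<noteq> 0"
      using I by (fastforce simp: ideal_of_def zero_fun_def)
    have "I \<subseteq> ideal_gen ?C {\<lambda>_. c}"
    proof
      fix h assume "h \<in> I"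
      then obtain b where "h = (\<lambda>_. b)" using I by (auto simp: ideal_of_def)
      moreover have "(\<lambda>_. b / c) * (\<lambda>_. c) + 0 \<in> ideal_gen ?C {\<lambda>_. c}"
        by (intro ideal_gen.intros) auto
      ultimately show "h \<in> ideal_gen ?C {\<lambda>_. c}" using c(2) by (simp add: times_fun_def)
    qed
    with c(1) show ?thesis by blast
  qed
qed

text \<open>
  The ring arises from the constants, which form a field, by adjoining the coordinates one by one.
  The induction only controls a ring \<open>R\<close> between the constants with these coordinates and \<open>polyfun\<close>;
  once all coordinates are in, \<open>R\<close> must be everything.
\<close>

lemma noetherian_polyfun: "noetherian (polyfun :: (complex^'n::finite \<Rightarrow> complex) set)"
proof -
  let ?C = "range (\<lambda>c::complex. (\<lambda>_::complex^'n. c))"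
  have "\<exists>R. subring R \<and> noetherian R \<and> ?C \<subseteq> R \<and> R \<subseteq> polyfun \<and> (\<forall>i\<in>S. (\<lambda>q. q $ i) \<in> R)"
    if "finite S" for S :: "'n set"
    using that
  proof (induction S)
    case empty
    have "subring ?C"
      by (auto simp: subring_def plus_fun_def times_fun_def zero_fun_def one_fun_def fun_Compl_def)
    then show ?case using noetherian_constants by (intro exI[of _ ?C]) (auto intro: polyfun.const)
  next
    case (insert i S)
    then obtain R where R: "subring R" "noetherian R" "?C \<subseteq> R" "R \<subseteq> polyfun" "\<forall>i\<in>S. (\<lambda>q. q $ i) \<in> R"
      by blast
    let ?x = "\<lambda>q :: complex^'n. q $ i"
    have pw: "?x ^ k \<in> polyfun" for k
      by (induction k)
        (auto intro: polyfun.intros)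
    have sum_mem: "sum f A \<in> polyfun" if "\<And>a. a \<in> A \<Longrightarrow> f a \<in> polyfun"
      for A and f :: "nat \<Rightarrow> complex^'n \<Rightarrow> complex"
      using that by (induction A rule: infinite_finite_induct)
        (auto intro: subring_0[OF subring_polyfun] subring_add[OF subring_polyfun])
    have "adjoin R ?x \<subseteq> polyfun"
    proof
      fix p assume "p \<in> adjoin R ?x"
      then obtain b d where "\<forall>k. b k \<in> R" "p = (\<Sum>k<(d::nat). b k * ?x ^ k)"
        by (auto simp: adjoin_def low_degree_def)
      then show "p \<in> polyfun"
        using R(4) pw by (auto intro!: sum_mem subring_mult[OF subring_polyfun])
    qed
    then show ?case
      using R base_subset_adjoin[OF R(1), of ?x] generator_in_adjoin[OF R(1), of ?x]
        subring_adjoin[OF R(1), of ?x] hilbert_basis[OF R(1,2), of ?x]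
      by (intro exI[of _ "adjoin R ?x"]) auto
  qed
  from this[of UNIV] obtain R where R: "subring R" "noetherian R" "?C \<subseteq> R" "R \<subseteq> polyfun"
    "\<And>i. (\<lambda>q. q $ i) \<in> R" by auto
  have "f \<in> R" if "f \<in> polyfun" for f
    using that
  proof induction
    case (add f g)
    then show ?case using subring_add[OF R(1)] by (auto simp: plus_fun_def)
  next
    case (mult f g)
    then show ?case using subring_mult[OF R(1)] by (auto simp: times_fun_def)
  qed (use R in auto)
  with R show ?thesis by (metis subsetI subset_antisym)
qed

definition partial_deriv :: "'n::finite \<Rightarrow> (complex^'n \<Rightarrow> complex) \<Rightarrow> complex^'n \<Rightarrow> complex" where
  "partial_deriv j h q = frechet_derivative h (at q) (axis j 1)"

definition grad :: "(complex^'n::finite \<Rightarrow> complex) \<Rightarrow> complex^'n \<Rightarrow> complex^'n" where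
  "grad h q = (\<chi> j. partial_deriv j h q)"

lemma partial_deriv_eqI:
  assumes "(h has_derivative (\<lambda>v. \<Sum>j\<in>UNIV. d j * v $ j)) (at q)"
  shows "partial_deriv i h q = d i"
proof -
  have "frechet_derivative h (at q) = (\<lambda>v. \<Sum>j\<in>UNIV. d j * v $ j)"
    using frechet_derivative_at[OF assms] by simp
  then show ?thesis by (simp add: partial_deriv_def axis_def if_distrib[of "\<lambda>x. _ * x"] cong: if_cong)
qed

text \<open>
  That the partial derivatives are again polynomial and that the real Frechet derivative is the
  complex linear form with these coefficients are proved by one induction over the construction of \<open>h\<close>.
\<close>

lemma polyfun_derivative:
  assumes "h \<in> polyfun"
  shows "partial_deriv j h \<in> polyfun" and "(h has_derivative (\<lambda>v. \<Sum>j\<in>UNIV. partial_deriv j h q * v $ j)) (at q)"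
proof -
  have "\<exists>d. (\<forall>j. d j \<in> polyfun) \<and> (\<forall>q. (h has_derivative (\<lambda>v. \<Sum>j\<in>UNIV. d j q * v $ j)) (at q))"
    using assms
  proof induction
    case (const c)
    show ?case by (rule exI[of _ "\<lambda>_ _. 0"]) (auto intro: polyfun.const)
  next
    case (coord i)
    have "((\<lambda>q. q $ i) has_derivative (\<lambda>v. \<Sum>j\<in>UNIV. (if j = i then 1 else 0) * v $ j)) (at q)"
      for q :: "complex^'a"
      by (auto simp: if_distrib[of "\<lambda>x. x * _"] bounded_linear_vec_nth bounded_linear_imp_has_derivative cong: if_cong)
    then show ?case
      by (intro exI[of _ "\<lambda>j _. if j = i then 1 else 0"]) (auto intro: polyfun.const)
  next
    case (add f g)
    then obtain d e where "\<forall>j. d j \<in> polyfun" "\<forall>j. e j \<in> polyfun"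
      "\<And>q. (f has_derivative (\<lambda>v. \<Sum>j\<in>UNIV. d j q * v $ j)) (at q)"
      "\<And>q. (g has_derivative (\<lambda>v. \<Sum>j\<in>UNIV. e j q * v $ j)) (at q)" by blast
    then show ?case
      by (intro exI[of _ "\<lambda>j q. d j q + e j q"])
        (auto intro!: polyfun.add derivative_eq_intros simp: algebra_simps sum.distrib)
  next
    case (mult f g)
    then obtain d e where "\<forall>j. d j \<in> polyfun" "\<forall>j. e j \<in> polyfun"
      "\<And>q. (f has_derivative (\<lambda>v. \<Sum>j\<in>UNIV. d j q * v $ j)) (at q)"
      "\<And>q. (g has_derivative (\<lambda>v. \<Sum>j\<in>UNIV. e j q * v $ j)) (at q)" by blast
    then show ?case
      using mult.hyps
      by (intro exI[of _ "\<lambda>j q. f q * e j q + d j q * g q"])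
        (auto intro!: polyfun.add polyfun.mult derivative_eq_intros
          simp: algebra_simps sum.distrib sum_distrib_left)
  qed
  then obtain d where d: "\<And>j. d j \<in> polyfun"
    "\<And>q. (h has_derivative (\<lambda>v. \<Sum>j\<in>UNIV. d j q * v $ j)) (at q)" by blast
  have "partial_deriv j h = d j" for j using partial_deriv_eqI[OF d(2)] by auto
  then show "partial_deriv j h \<in> polyfun" "(h has_derivative (\<lambda>v. \<Sum>j\<in>UNIV. partial_deriv j h q * v $ j)) (at q)"
    using d by auto
qed

lemma polyfun_continuous_on: "h \<in> polyfun \<Longrightarrow> continuous_on S h"
  by (induction rule: polyfun.induct) (auto intro!: continuous_intros)

lemma partial_deriv_coord: "partial_deriv j (\<lambda>q. q $ i) q = (if j = i then 1 else 0)"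
proof (rule partial_deriv_eqI)
  show "((\<lambda>q. q $ i) has_derivative (\<lambda>v. \<Sum>j\<in>UNIV. (if j = i then 1 else 0) * v $ j)) (at q)"
    by (auto simp: if_distrib[of "\<lambda>x. x * _"] bounded_linear_vec_nth bounded_linear_imp_has_derivative cong: if_cong)
qed

section \<open>Cramer's rule for covectors\<close>

text \<open>
  The covector \<open>u\<close> is a combination of the rows of \<open>A\<close>, and Cramer's rule expresses the coefficients
  as quotients of determinants.
\<close>

lemma cramer_covector:
  fixes A :: "'a::field^'n^'n"
  assumes A: "det A \<noteq> 0"
  shows "det A * (\<Sum>j\<in>UNIV. u $ j * v $ j) = (\<Sum>k\<in>UNIV. det (\<chi> i. if i = k then u else A $ i) * (A *v v) $ k)"
proof -
  have "det (transpose A) \<noteq> 0" using A by simp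
  then obtain y where y: "transpose A *v y = u" using cramer by blast
  have u: "u = (\<Sum>i\<in>UNIV. y $ i *s row i A)"
    unfolding y[symmetric] matrix_mult_sum by simp
  have "det (\<chi> i. if i = k then u else A $ i) = y $ k * det A" for k
    using cramer_lemma_transpose[of k y A, folded u] unfolding row_def vec_lambda_eta .
  then have "(\<Sum>k\<in>UNIV. det (\<chi> i. if i = k then u else A $ i) * (A *v v) $ k)
      = det A * (\<Sum>k\<in>UNIV. \<Sum>j\<in>UNIV. y $ k * A $ k $ j * v $ j)"
    by (simp add: matrix_vector_mult_def sum_distrib_left mult_ac)
  also have "\<dots> = det A * (\<Sum>j\<in>UNIV. \<Sum>k\<in>UNIV. y $ k * A $ k $ j * v $ j)"
    by (subst sum.swap) (rule refl)
  finally show ?thesis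
    unfolding u by (simp add: sum_component row_def sum_distrib_right)
qed

section \<open>A Gronwall estimate\<close>

text \<open>
  The energy \<open>E = \<Sum>\<^sub>t |u\<^sub>t|\<^sup>2\<close> satisfies \<open>E' \<le> c E\<close>, so \<open>E(s) exp (-c s)\<close> is nonincreasing; it starts
  at zero and is nonnegative.
\<close>

lemma linear_growth_from_zero:
  fixes u u' :: "'t \<Rightarrow> real \<Rightarrow> 'v::real_inner"
  assumes T: "finite T"
    and deriv: "\<And>t s. t \<in> T \<Longrightarrow> s \<in> {0..1} \<Longrightarrow> (u t has_vector_derivative u' t s) (at s)"
    and bound: "\<And>t s. t \<in> T \<Longrightarrow> s \<in> {0..1} \<Longrightarrow> norm (u' t s) \<le> K * (\<Sum>i\<in>T. norm (u i s))"
    and init: "\<And>t. t \<in> T \<Longrightarrow> u t 0 = 0"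
    and s: "s \<in> {0..1}" and t: "t \<in> T"
  shows "u t s = 0"
proof -
  define c where "c = 2 * K * card T"
  define E where "E s = (\<Sum>t\<in>T. u t s \<bullet> u t s)" for s
  have K: "K * (\<Sum>i\<in>T. norm (u i s)) \<ge> 0" if "s \<in> {0..1}" for s
    using bound[OF t that] norm_ge_zero order_trans by blast
  have E': "(E has_real_derivative (\<Sum>t\<in>T. 2 * (u t s \<bullet> u' t s))) (at s)" if "s \<in> {0..1}" for s
    unfolding E_def
  proof (rule DERIV_sum)
    fix t assume "t \<in> T"
    note d = deriv[OF this that, unfolded has_vector_derivative_def]
    show "((\<lambda>s. u t s \<bullet> u t s) has_real_derivative 2 * (u t s \<bullet> u' t s)) (at s)"
      unfolding has_field_derivative_def
      by (rule has_derivative_eq_rhs[OF has_derivative_inner[OF d d]]) (auto simp: inner_commute)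
  qed
  have le: "(\<Sum>t\<in>T. 2 * (u t s \<bullet> u' t s)) \<le> c * E s" if s: "s \<in> {0..1}" for s
  proof -
    let ?S = "\<Sum>i\<in>T. norm (u i s)"
    have "(\<Sum>t\<in>T. 2 * (u t s \<bullet> u' t s)) \<le> (\<Sum>t\<in>T. 2 * (norm (u t s) * (K * ?S)))"
    proof (intro sum_mono)
      fix t assume "t \<in> T"
      have "u t s \<bullet> u' t s \<le> norm (u t s) * norm (u' t s)" by (rule norm_cauchy_schwarz)
      also have "\<dots> \<le> norm (u t s) * (K * ?S)"
        by (intro mult_left_mono bound \<open>t \<in> T\<close> s) simp
      finally show "2 * (u t s \<bullet> u' t s) \<le> 2 * (norm (u t s) * (K * ?S))" by simp
    qed
    also have "\<dots> = 2 * K * ?S\<^sup>2"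
      by (simp add: sum_distrib_left sum_distrib_right power2_eq_square mult_ac)
    also have "\<dots> \<le> c * E s"
    proof (cases "?S = 0")
      case True
      then have "norm (u i s) = 0" if "i \<in> T" for i
        using sum_nonneg_eq_0_iff[OF T, of "\<lambda>i. norm (u i s)"] that by simp
      then have "E s = 0" by (simp add: E_def)
      with True show ?thesis by simp
    next
      case False
      then have "?S > 0" by (simp add: less_le sum_nonneg)
      then have "K \<ge> 0" using K[OF s] by (simp add: zero_le_mult_iff)
      moreover have "?S\<^sup>2 \<le> card T * E s"
        using sum_squared_le_sum_of_squares[of "\<lambda>i. norm (u i s)" T]
        by (simp add: E_def power2_norm_eq_inner mult.commute)
      ultimately show ?thesis
        using mult_left_mono[of "?S\<^sup>2" "card T * E s" "2 * K"] by (simp add: c_def mult_ac)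
    qed
    finally show ?thesis .
  qed
  have "E s * exp (- c * s) \<le> E 0 * exp (- c * 0)"
  proof (rule DERIV_nonpos_imp_nonincreasing[of 0 s "\<lambda>s. E s * exp (- c * s)"])
    fix r assume "0 \<le> r" "r \<le> s"
    then have r: "r \<in> {0..1}" using s by auto
    have "((\<lambda>s. E s * exp (- c * s)) has_real_derivative
        ((\<Sum>t\<in>T. 2 * (u t r \<bullet> u' t r)) - c * E r) * exp (- c * r)) (at r)"
      by (auto intro!: derivative_eq_intros E'[OF r] simp: algebra_simps)
    moreover have "((\<Sum>t\<in>T. 2 * (u t r \<bullet> u' t r)) - c * E r) * exp (- c * r) \<le> 0"
      using le[OF r] by (simp add: mult_le_0_iff)
    ultimately show "\<exists>y. ((\<lambda>s. E s * exp (- c * s)) has_real_derivative y) (at r) \<and> y \<le> 0" by blast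
  qed (use s in auto)
  moreover have "E 0 = 0" using init by (simp add: E_def)
  ultimately have "E s \<le> 0" by (simp add: mult_le_0_iff)
  moreover have "u t s \<bullet> u t s \<le> E s"
    unfolding E_def by (rule member_le_sum[OF t]) (use T in auto)
  ultimately show ?thesis by (metis inner_gt_zero_iff leD order_trans)
qed

section \<open>Polynomial local coordinates\<close>

definition jac :: "('n::finite \<Rightarrow> complex^'n \<Rightarrow> complex) \<Rightarrow> complex^'n \<Rightarrow> complex^'n^'n" where
  "jac G q = (\<chi> i. grad (G i) q)"

lemma polyfun_det_jac:
  assumes "\<And>i. G i \<in> polyfun"
  shows "(\<lambda>q. det (jac G q)) \<in> polyfun"
  unfolding jac_def grad_def using assms by (intro polyfun_det polyfun_derivative(1))

lemma jac_upd: "jac (G(k := h)) q = (\<chi> i. if i = k then grad h q else jac G q $ i)"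
  by (simp add: jac_def vec_eq_iff)

text \<open>
  Where their Jacobian determinant is nonzero, the polynomials \<open>G\<close> form local coordinates by the
  inverse function theorem. In these coordinates the path is the straight segment from \<open>p\<close> to \<open>q\<close>,
  so every \<open>G i\<close> changes along it at the constant rate \<open>G i q - G i p\<close>; in particular, those \<open>G i\<close>
  that take the same value at \<open>p\<close> and \<open>q\<close> stay constant.
\<close>

lemma straight_path:
  fixes G :: "'n::finite \<Rightarrow> complex^'n \<Rightarrow> complex"
  assumes G: "\<And>i. G i \<in> polyfun" and p: "det (jac G p) \<noteq> 0"
  obtains U where "open U" "p \<in> U"
    "\<And>q. q \<in> U \<Longrightarrow> \<exists>\<gamma> \<gamma>'. \<gamma> 0 = p \<and> \<gamma> 1 = q \<and> (\<forall>s\<in>{0..1::real}.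
       (\<gamma> has_vector_derivative \<gamma>' s) (at s) \<and> det (jac G (\<gamma> s)) \<noteq> 0 \<and>
       jac G (\<gamma> s) *v \<gamma>' s = (\<chi> i. G i q - G i p))"
proof -
  define H where "H q = (\<chi> i. G i q)" for q
  define H' where "H' q = Blinfun ((*v) (jac G q))" for q
  define U0 where "U0 = {q. det (jac G q) \<noteq> 0}"
  have H': "blinfun_apply (H' q) = (*v) (jac G q)" for q
    unfolding H'_def by (simp add: bounded_linear_Blinfun_apply)
  have "open U0"
    unfolding U0_def
    by (intro open_Collect_neq continuous_on_const polyfun_continuous_on polyfun_det_jac G)
  have der: "(H has_derivative blinfun_apply (H' q)) (at q)" for q
  proof -
    have "((\<lambda>q. H q $ i) has_derivative (\<lambda>v. (jac G q *v v) $ i)) (at q)" for i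
      using polyfun_derivative(2)[OF G, of i q] by (simp add: H_def jac_def grad_def matrix_vector_mult_def)
    then show ?thesis unfolding H' by (subst has_derivative_componentwise_within) (auto simp: Basis_vec_def inner_axis intro: has_derivative_inner_left)
  qed
  have cont: "continuous_on U0 H'"
  proof (rule continuous_on_blinfun_componentwise)
    fix v :: "complex^'n"
    show "continuous_on U0 (\<lambda>q. blinfun_apply (H' q) v)"
      unfolding H' matrix_vector_mult_def jac_def grad_def
      by (intro continuous_on_vec_lambda continuous_on_sum continuous_on_mult continuous_on_const)
        (simp add: polyfun_continuous_on polyfun_derivative(1) G)
  qed
  have "p \<in> U0" using p by (simp add: U0_def)
  obtain B where B: "B ** jac G p = mat 1"
    using p invertible_det_nz[of "jac G p"] by (auto simp: invertible_def)
  have inv: "Blinfun ((*v) B) o\<^sub>L H' p = id_blinfun"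
    by (rule blinfun_eqI) (simp add: H' bounded_linear_Blinfun_apply matrix_vector_mul_assoc B)
  obtain U V g g' where U: "open U" "U \<subseteq> U0" "p \<in> U" "open V" "H p \<in> V" "homeomorphism U V H g"
    and g: "\<And>y. y \<in> V \<Longrightarrow> (g has_derivative g' y) (at y)"
    and g': "\<And>y. y \<in> V \<Longrightarrow> g' y = inv (blinfun_apply (H' (g y)))"
    and bij: "\<And>y. y \<in> V \<Longrightarrow> bij (blinfun_apply (H' (g y)))"
    using inverse_function_theorem[OF \<open>open U0\<close> der cont \<open>p \<in> U0\<close> inv] by metis
  obtain e where e: "e > 0" "ball (H p) e \<subseteq> V" using U(4,5) openE by blast
  define W where "W = U \<inter> H -` ball (H p) e"
  have contH: "continuous_on U H"
    by (rule has_derivative_continuous_on) (rule has_derivative_at_withinI[OF der])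
  show ?thesis
  proof (rule that)
    show "open W" unfolding W_def using contH U(1) by (intro continuous_open_preimage) auto
    show "p \<in> W" using U(3) e by (simp add: W_def)
    fix q assume q: "q \<in> W"
    define l where "l s = H p + s *\<^sub>R (H q - H p)" for s
    have lV: "l s \<in> V" if "s \<in> {0..1}" for s
    proof -
      have "l s = (1 - s) *\<^sub>R H p + s *\<^sub>R H q" by (simp add: l_def algebra_simps)
      moreover have "H p \<in> ball (H p) e" "H q \<in> ball (H p) e" using q e by (auto simp: W_def)
      ultimately have "l s \<in> ball (H p) e"
        using that convex_ball[of "H p" e] unfolding convex_alt by (metis atLeastAtMost_iff)
      then show ?thesis using e by blast
    qed
    define \<gamma> where "\<gamma> s = g (l s)" for s
    define \<gamma>' where "\<gamma>' s = g' (l s) (H q - H p)" for s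
    have "\<gamma> 0 = p" "\<gamma> 1 = q"
      using U(3,6) q by (auto simp: \<gamma>_def l_def homeomorphism_def W_def)
    moreover have "(\<gamma> has_vector_derivative \<gamma>' s) (at s)" if "s \<in> {0..1}" for s
    proof -
      have "(l has_derivative (\<lambda>r. r *\<^sub>R (H q - H p))) (at s)"
        unfolding l_def by (auto intro!: derivative_eq_intros)
      from has_derivative_compose[OF this g[OF lV[OF that]]]
      have "(\<gamma> has_derivative (\<lambda>r. g' (l s) (r *\<^sub>R (H q - H p)))) (at s)"
        by (simp add: \<gamma>_def[abs_def])
      moreover have "g' (l s) (r *\<^sub>R (H q - H p)) = r *\<^sub>R \<gamma>' s" for r
        using g[OF lV[OF that]] unfolding \<gamma>'_def
        by (simp add: linear_cmul has_derivative_linear)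
      ultimately show ?thesis by (simp add: has_vector_derivative_def)
    qed
    moreover have "det (jac G (\<gamma> s)) \<noteq> 0" if "s \<in> {0..1}" for s
      using lV[OF that] U(2,6) by (force simp: \<gamma>_def homeomorphism_def U0_def)
    moreover have "jac G (\<gamma> s) *v \<gamma>' s = (\<chi> i. G i q - G i p)" if "s \<in> {0..1}" for s
    proof -
      have "blinfun_apply (H' (g (l s))) (g' (l s) (H q - H p)) = H q - H p"
        using bij[OF lV[OF that]] by (simp add: g'[OF lV[OF that]] bij_is_surj surj_f_inv_f)
      then show ?thesis by (simp add: H' \<gamma>_def \<gamma>'_def H_def vec_eq_iff)
    qed
    ultimately show "\<exists>\<gamma> \<gamma>'. \<gamma> 0 = p \<and> \<gamma> 1 = q \<and> (\<forall>s\<in>{0..1::real}.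
       (\<gamma> has_vector_derivative \<gamma>' s) (at s) \<and> det (jac G (\<gamma> s)) \<noteq> 0 \<and>
       jac G (\<gamma> s) *v \<gamma>' s = (\<chi> i. G i q - G i p))" by blast
  qed
qed

definition differential :: "(complex^'n::finite \<Rightarrow> complex) \<Rightarrow> complex^'n \<Rightarrow> complex^'n \<Rightarrow> complex" where
  "differential h q v = (\<Sum>j\<in>UNIV. partial_deriv j h q * v $ j)"

lemma differential_grad: "differential h q v = (\<Sum>j\<in>UNIV. grad h q $ j * v $ j)"
  by (simp add: differential_def grad_def)

lemma jac_mult: "(jac G q *v v) $ i = differential (G i) q v"
  by (simp add: jac_def differential_grad matrix_vector_mult_def)

lemma cramer_differential:
  assumes "det (jac G q) \<noteq> 0"
  shows "det (jac G q) * differential h q v = (\<Sum>k\<in>UNIV. det (jac (G(k := h)) q) * differential (G k) q v)"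
  unfolding differential_grad[of h] jac_upd cramer_covector[OF assms] by (simp add: jac_mult)

lemma polyfun_along_path:
  assumes "h \<in> polyfun" "(\<gamma> has_vector_derivative \<gamma>') (at s)"
  shows "((\<lambda>s. h (\<gamma> s)) has_vector_derivative differential h (\<gamma> s) \<gamma>') (at s)"
proof -
  have "((\<lambda>s. h (\<gamma> s)) has_derivative (\<lambda>r. \<Sum>j\<in>UNIV. partial_deriv j h (\<gamma> s) * (r *\<^sub>R \<gamma>') $ j)) (at s)"
    using has_derivative_compose[OF assms(2)[unfolded has_vector_derivative_def] polyfun_derivative(2)[OF assms(1)]] .
  then show ?thesis
    by (simp add: has_vector_derivative_def differential_def scaleR_sum_right)
qed

section \<open>Countability of critical values\<close>

definition vanishing :: "(complex^'n) set \<Rightarrow> (complex^'n \<Rightarrow> complex) set" where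
  "vanishing A = {h \<in> polyfun. \<forall>q\<in>A. h q = 0}"

lemma ideal_of_vanishing: "ideal_of polyfun (vanishing A)"
  using subring_polyfun unfolding subring_def ideal_of_def vanishing_def by auto

lemma finite_generators_vanishing:
  obtains T c where "finite T" "T \<subseteq> vanishing A"
    "\<forall>h\<in>vanishing A. (\<forall>t. c h t \<in> polyfun) \<and> (\<forall>q. h q = (\<Sum>t\<in>T. c h t q * t q))"
proof -
  obtain T where T: "finite T" "T \<subseteq> vanishing A" "vanishing A \<subseteq> ideal_gen polyfun T"
    using noetherian_polyfun ideal_of_vanishing unfolding noetherian_def by meson
  have app: "(\<Sum>t\<in>T. f t) q = (\<Sum>t\<in>T. f t q)" for f :: "(complex^'a \<Rightarrow> complex) \<Rightarrow> complex^'a \<Rightarrow> complex" and q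
    using T(1) by (induction T) auto
  have "\<exists>c. (\<forall>t. c t \<in> polyfun) \<and> (\<forall>q. h q = (\<Sum>t\<in>T. c t q * t q))" if "h \<in> vanishing A" for h
  proof -
    have "h \<in> ideal_gen polyfun ((\<lambda>t. t) ` T)" using T(3) that by auto
    from ideal_gen_finite_image[OF subring_polyfun T(1) this]
    obtain c where "\<And>t. c t \<in> polyfun" "h = (\<Sum>t\<in>T. c t * t)" by blast
    then show ?thesis by (auto simp: app)
  qed
  then have "\<forall>h\<in>vanishing A. \<exists>c. (\<forall>t. c t \<in> polyfun) \<and> (\<forall>q. h q = (\<Sum>t\<in>T. c t q * t q))" by blast
  from bchoice[OF this] obtain c where
    "\<forall>h\<in>vanishing A. (\<forall>t. c h t \<in> polyfun) \<and> (\<forall>q. h q = (\<Sum>t\<in>T. c h t q * t q))" ..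
  then show ?thesis by (rule that[OF T(1,2)])
qed

text \<open>
  The dual formulation of the condition that the differential of \<open>f\<close> is a combination of the
  differentials of the polynomials vanishing on \<open>A\<close>. The set \<open>A\<close> may be
  arbitrary, in particular not closed, and the property passes to subsets because their ideals are
  larger.
\<close>

definition critical_on :: "(complex^'n::finite \<Rightarrow> complex) \<Rightarrow> (complex^'n) set \<Rightarrow> bool" where
  "critical_on f A \<longleftrightarrow> (\<forall>q\<in>A. \<forall>v. (\<forall>h\<in>vanishing A. differential h q v = 0) \<longrightarrow> differential f q v = 0)"

lemma vanishing_antimono: "B \<subseteq> A \<Longrightarrow> vanishing A \<subseteq> vanishing B"
  by (auto simp: vanishing_def)

lemma critical_on_subset: "critical_on f A \<Longrightarrow> B \<subseteq> A \<Longrightarrow> critical_on f B"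
  unfolding critical_on_def using vanishing_antimono[of B A] by blast

text \<open>
  Choose the system \<open>G\<close> with as many members as possible in the ideal of \<open>A\<close>; the coordinate functions
  show that there is a system to start from. If a determinant as in the last conclusion were nonzero
  somewhere on \<open>A\<close>, exchanging \<open>G k\<close> for \<open>h\<close> would produce a system with more members in the ideal.
\<close>

lemma adapted_coordinates:
  assumes "A \<noteq> {}"
  obtains G :: "'n::finite \<Rightarrow> complex^'n \<Rightarrow> complex" where "\<And>i. G i \<in> polyfun"
    "\<exists>q\<in>A. det (jac G q) \<noteq> 0"
    "\<And>h k q. \<lbrakk>h \<in> vanishing A; G k \<notin> vanishing A; q \<in> A\<rbrakk> \<Longrightarrow> det (jac (G(k := h)) q) = 0"
proof -
  define P where "P G \<longleftrightarrow> (\<forall>i. G i \<in> polyfun) \<and> (\<exists>q\<in>A. det (jac G q) \<noteq> 0)" for G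
  define m where "m G = card {i. G i \<in> vanishing A}" for G :: "'n \<Rightarrow> complex^'n \<Rightarrow> complex"
  have "jac (\<lambda>i q. q $ i) q = mat 1" for q :: "complex^'n"
    by (auto simp: jac_def grad_def partial_deriv_coord mat_def vec_eq_iff)
  then have "P (\<lambda>i q. q $ i)" using assms by (auto simp: P_def intro: polyfun.coord)
  moreover have "\<forall>G. P G \<longrightarrow> m G < Suc CARD('n)"
    unfolding m_def by (auto simp: less_Suc_eq_le intro: card_mono)
  ultimately obtain G where G: "P G" "\<And>G'. P G' \<Longrightarrow> m G' \<le> m G"
    using ex_has_greatest_nat[of P "\<lambda>i q. q $ i" m "Suc CARD('n)"] by blast
  have "det (jac (G(k := h)) q) = 0" if h: "h \<in> vanishing A" "G k \<notin> vanishing A" "q \<in> A" for h k q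
  proof (rule ccontr)
    assume "det (jac (G(k := h)) q) \<noteq> 0"
    then have "P (G(k := h))" using G(1) h by (auto simp: P_def vanishing_def)
    then have "m (G(k := h)) \<le> m G" by (rule G(2))
    moreover have "{i. (G(k := h)) i \<in> vanishing A} = insert k {i. G i \<in> vanishing A}"
      using h by auto
    then have "m (G(k := h)) = Suc (m G)" using h by (simp add: m_def)
    ultimately show False by simp
  qed
  with G(1) that show ?thesis unfolding P_def by blast
qed

text \<open>
  The members of \<open>G\<close> in the ideal of \<open>A\<close> cut out a manifold near \<open>p\<close>; the proof shows that this
  manifold lies in the Zariski closure of \<open>A\<close> and that \<open>f\<close> is constant on it. Both follow from the
  derivatives along straight paths in the coordinates \<open>G\<close>: those of the generators of the ideal by
  the uniqueness of solutions of linear differential equations, that of \<open>f\<close> by criticality.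
\<close>

lemma locally_constant:
  fixes A :: "(complex^'n::finite) set"
  assumes G: "\<And>i. G i \<in> polyfun"
    and maxi: "\<And>h k q. \<lbrakk>h \<in> vanishing A; G k \<notin> vanishing A; q \<in> A\<rbrakk> \<Longrightarrow> det (jac (G(k := h)) q) = 0"
    and f: "f \<in> polyfun" and crit: "critical_on f A"
    and p: "p \<in> A" "det (jac G p) \<noteq> 0"
  shows "\<exists>U. open U \<and> p \<in> U \<and> (\<forall>q\<in>U \<inter> A. f q = f p)"
proof -
  obtain T c where T: "finite T" "T \<subseteq> vanishing A"
    and c_gen: "\<forall>h\<in>vanishing A. (\<forall>t. c h t \<in> polyfun) \<and> (\<forall>q. h q = (\<Sum>t\<in>T. c h t q * t q))"
    by (rule finite_generators_vanishing[of A])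
  have c: "c h t \<in> polyfun" if "h \<in> vanishing A" for h t using c_gen that by blast
  have gen: "h q = (\<Sum>t\<in>T. c h t q * t q)" if "h \<in> vanishing A" for h q using c_gen that by blast
  have poly_det: "(\<lambda>q. det (jac (G(k := h)) q)) \<in> polyfun" if "h \<in> polyfun" for h k
    using G that by (intro polyfun_det_jac) auto
  define M where "M h k = (\<lambda>q. det (jac (G(k := h)) q))" for h k
  have M: "M h k \<in> vanishing A" if "h \<in> vanishing A" "G k \<notin> vanishing A" for h k
    using maxi that poly_det by (auto simp: vanishing_def M_def)
  \<comment> \<open>the factor \<open>det (jac G q)\<close> takes care of the points where Cramer's rule fails\<close>
  have f_minor: "(\<lambda>q. det (jac G q) * M f k q) \<in> vanishing A" if k: "G k \<notin> vanishing A" for k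
  proof -
    have "M f k q = 0" if q: "q \<in> A" "det (jac G q) \<noteq> 0" for q
    proof -
      \<comment> \<open>the dual basis vector of \<open>d(G k)\<close>: all differentials of the ideal kill it, hence so does that of \<open>f\<close>\<close>
      obtain v where v: "jac G q *v v = axis k 1" using cramer[OF q(2)] by blast
      then have vk: "differential (G i) q v = (if i = k then 1 else 0)" for i
        using jac_mult[of G q v i] by (simp add: axis_def)
      have eq: "det (jac G q) * differential h q v = M h k q" for h
        unfolding cramer_differential[OF q(2)] vk M_def by (simp add: if_distrib[of "\<lambda>x. _ * x"] cong: if_cong)
      have "differential h q v = 0" if "h \<in> vanishing A" for h
        using eq[of h] M[OF that k] q by (simp add: vanishing_def)
      then have "differential f q v = 0" using crit q(1) by (auto simp: critical_on_def)
      with eq[of f] show ?thesis by simp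
    qed
    then show ?thesis
      using poly_det[OF f] polyfun_det_jac[of G, OF G] by (auto simp: vanishing_def M_def intro: polyfun.mult)
  qed
  obtain U where U: "open U" "p \<in> U"
    "\<And>q. q \<in> U \<Longrightarrow> \<exists>\<gamma> \<gamma>'. \<gamma> 0 = p \<and> \<gamma> 1 = q \<and> (\<forall>s\<in>{0..1::real}.
       (\<gamma> has_vector_derivative \<gamma>' s) (at s) \<and> det (jac G (\<gamma> s)) \<noteq> 0 \<and>
       jac G (\<gamma> s) *v \<gamma>' s = (\<chi> i. G i q - G i p))"
    using straight_path[OF G p(2)] by blast
  have "f q = f p" if q: "q \<in> U" "q \<in> A" for q
  proof -
    obtain \<gamma> \<gamma>' where ends: "\<gamma> 0 = p" "\<gamma> 1 = q"
      and \<gamma>: "\<And>s. s \<in> {0..1::real} \<Longrightarrow> (\<gamma> has_vector_derivative \<gamma>' s) (at s)"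
      and det: "\<And>s. s \<in> {0..1::real} \<Longrightarrow> det (jac G (\<gamma> s)) \<noteq> 0"
      and jac: "\<And>s. s \<in> {0..1::real} \<Longrightarrow> jac G (\<gamma> s) *v \<gamma>' s = (\<chi> i. G i q - G i p)"
      using U(3)[OF q(1)] by blast
    define a where "a k = G k q - G k p" for k
    define N where "N = {k. G k \<notin> vanishing A}"
    have a0: "a k = 0" if "k \<notin> N" for k
      using that p(1) q(2) by (simp add: a_def N_def vanishing_def)
    have deriv: "det (jac G (\<gamma> s)) * differential h (\<gamma> s) (\<gamma>' s) = (\<Sum>k\<in>N. M h k (\<gamma> s) * a k)"
      if s: "s \<in> {0..1}" for h s
    proof -
      have "differential (G k) (\<gamma> s) (\<gamma>' s) = a k" for k
        using jac_mult[of G "\<gamma> s" "\<gamma>' s" k] jac[OF s] by (simp add: a_def)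
      then have "det (jac G (\<gamma> s)) * differential h (\<gamma> s) (\<gamma>' s) = (\<Sum>k\<in>UNIV. M h k (\<gamma> s) * a k)"
        unfolding cramer_differential[OF det[OF s]] M_def by simp
      also have "\<dots> = (\<Sum>k\<in>N. M h k (\<gamma> s) * a k)"
        using a0 by (intro sum.mono_neutral_right) auto
      finally show ?thesis .
    qed
    \<comment> \<open>a bound for the coefficients of the linear differential equation\<close>
    define bd where "bd s = (\<Sum>h\<in>T. \<Sum>k\<in>N. \<Sum>t\<in>T. norm (c (M h k) t (\<gamma> s) * a k / det (jac G (\<gamma> s))))" for s
    have cont\<gamma>: "continuous_on {0..1} \<gamma>"
      using \<gamma> by (meson continuous_at_imp_continuous_on has_vector_derivative_continuous)
    have cont: "continuous_on {0..1} (\<lambda>s. h (\<gamma> s))" if "h \<in> polyfun" for h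
      using continuous_on_compose[OF cont\<gamma> polyfun_continuous_on[OF that]] by (simp add: o_def)
    have "continuous_on {0..1} bd"
      unfolding bd_def using T(2)
      by (intro continuous_intros cont c M polyfun_det_jac G) (auto simp: N_def det)
    then have "bounded (bd ` {0..1})"
      by (intro compact_imp_bounded compact_continuous_image) auto
    then obtain K where "\<forall>y\<in>bd ` {0..1}. norm y \<le> K" unfolding bounded_iff by blast
    then have K: "bd s \<le> K" if "s \<in> {0..1}" for s using that by force
    \<comment> \<open>the path stays in the Zariski closure of \<open>A\<close>\<close>
    have zero: "h (\<gamma> s) = 0" if h: "h \<in> T" and s: "s \<in> {0..1}" for h s
    proof (rule linear_growth_from_zero[where u = "\<lambda>h s. h (\<gamma> s)" and T = T and K = K
          and u' = "\<lambda>h s. differential h (\<gamma> s) (\<gamma>' s)"])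
      fix h s assume h: "h \<in> T" and s: "s \<in> {0..1::real}"
      have hv: "h \<in> vanishing A" using h T(2) by blast
      show "((\<lambda>s. h (\<gamma> s)) has_vector_derivative differential h (\<gamma> s) (\<gamma>' s)) (at s)"
        using hv by (intro polyfun_along_path \<gamma> s) (simp add: vanishing_def)
      have "differential h (\<gamma> s) (\<gamma>' s) = (\<Sum>k\<in>N. M h k (\<gamma> s) * a k) / det (jac G (\<gamma> s))"
        using deriv[OF s, of h] det[OF s] by (simp add: field_simps)
      also have "\<dots> = (\<Sum>k\<in>N. \<Sum>t\<in>T. c (M h k) t (\<gamma> s) * a k / det (jac G (\<gamma> s)) * t (\<gamma> s))"
        unfolding sum_divide_distrib
      proof (intro sum.cong refl)
        fix k assume "k \<in> N"
        then have "M h k \<in> vanishing A" using M[OF hv] by (simp add: N_def)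
        from gen[OF this]
        show "M h k (\<gamma> s) * a k / det (jac G (\<gamma> s)) = (\<Sum>t\<in>T. c (M h k) t (\<gamma> s) * a k / det (jac G (\<gamma> s)) * t (\<gamma> s))"
          by (simp add: sum_distrib_left sum_divide_distrib mult_ac)
      qed
      finally have "norm (differential h (\<gamma> s) (\<gamma>' s)) \<le>
          (\<Sum>k\<in>N. \<Sum>t\<in>T. norm (c (M h k) t (\<gamma> s) * a k / det (jac G (\<gamma> s))) * norm (t (\<gamma> s)))"
        by (simp only:) (intro order_trans[OF norm_sum] sum_mono, simp add: norm_mult norm_divide)
      also have "\<dots> \<le> (\<Sum>k\<in>N. \<Sum>t\<in>T. norm (c (M h k) t (\<gamma> s) * a k / det (jac G (\<gamma> s))) * (\<Sum>i\<in>T. norm (i (\<gamma> s))))"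
        using T(1) by (intro sum_mono mult_left_mono member_le_sum) auto
      also have "\<dots> = (\<Sum>k\<in>N. \<Sum>t\<in>T. norm (c (M h k) t (\<gamma> s) * a k / det (jac G (\<gamma> s)))) * (\<Sum>i\<in>T. norm (i (\<gamma> s)))"
        by (simp add: sum_distrib_right)
      also have "\<dots> \<le> bd s * (\<Sum>i\<in>T. norm (i (\<gamma> s)))"
        unfolding bd_def using h T(1)
        by (intro mult_right_mono sum_nonneg
            member_le_sum[of h T "\<lambda>h. \<Sum>k\<in>N. \<Sum>t\<in>T. norm (c (M h k) t (\<gamma> s) * a k / det (jac G (\<gamma> s)))"]) auto
      also have "\<dots> \<le> K * (\<Sum>i\<in>T. norm (i (\<gamma> s)))"
        using K[OF s] by (intro mult_right_mono sum_nonneg) auto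
      finally show "norm (differential h (\<gamma> s) (\<gamma>' s)) \<le> K * (\<Sum>i\<in>T. norm (i (\<gamma> s)))" .
    next
      fix h assume "h \<in> T"
      then show "h (\<gamma> 0) = 0" using T(2) p(1) by (auto simp: ends vanishing_def)
    qed (use T(1) h s in auto)
    have f': "((\<lambda>s. f (\<gamma> s)) has_vector_derivative 0) (at s)" if s: "s \<in> {0..1}" for s
    proof -
      have "M f k (\<gamma> s) = 0" if "k \<in> N" for k
      proof -
        have "G k \<notin> vanishing A" using that by (simp add: N_def)
        note gen[OF f_minor[OF this], of "\<gamma> s"]
        also have "(\<Sum>t\<in>T. c (\<lambda>q. det (jac G q) * M f k q) t (\<gamma> s) * t (\<gamma> s)) = 0"
        proof (intro sum.neutral ballI)
          fix t assume "t \<in> T"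
          from zero[OF this s]
          show "c (\<lambda>q. det (jac G q) * M f k q) t (\<gamma> s) * t (\<gamma> s) = 0" by simp
        qed
        finally show ?thesis using det[OF s] by simp
      qed
      then have "differential f (\<gamma> s) (\<gamma>' s) = 0" using deriv[OF s, of f] det[OF s] by simp
      then show ?thesis using polyfun_along_path[OF f \<gamma>[OF s]] by simp
    qed
    obtain y where "\<And>s. s \<in> {0..1} \<Longrightarrow> f (\<gamma> s) = y"
      using has_vector_derivative_zero_constant[of "{0..1}" "\<lambda>s. f (\<gamma> s)"]
        has_vector_derivative_at_within[OF f'] by (metis convex_real_interval(5))
    from this[of 0] this[of 1] have "f (\<gamma> 1) = f (\<gamma> 0)" by simp
    then show ?thesis by (simp add: ends)
  qed
  with U show ?thesis by blast
qed

lemma countable_image_if_locally_constant: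
  fixes X :: "'a::second_countable_topology set"
  assumes "\<And>p. p \<in> X \<Longrightarrow> \<exists>U. open U \<and> p \<in> U \<and> (\<forall>q\<in>U \<inter> X. f q = f p)"
  shows "countable (f ` X)"
proof -
  define \<F> where "\<F> = {U. open U \<and> (\<exists>y. f ` (U \<inter> X) \<subseteq> {y})}"
  obtain \<F>' where F: "\<F>' \<subseteq> \<F>" "countable \<F>'" "\<Union>\<F>' = \<Union>\<F>"
    using Lindelof[of \<F>] by (auto simp: \<F>_def)
  have "X \<subseteq> \<Union>\<F>"
  proof
    fix p assume "p \<in> X"
    from assms[OF this] obtain U where "open U" "p \<in> U" "\<forall>q\<in>U \<inter> X. f q = f p" by blast
    then have "U \<in> \<F>" unfolding \<F>_def by blast
    with \<open>p \<in> U\<close> show "p \<in> \<Union>\<F>" by blast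
  qed
  then have "f ` X \<subseteq> (\<Union>U\<in>\<F>'. f ` (U \<inter> X))" using F(3) by blast
  moreover have "countable (f ` (U \<inter> X))" if "U \<in> \<F>'" for U
  proof -
    have "U \<in> \<F>" using F(1) that by blast
    then obtain y where "f ` (U \<inter> X) \<subseteq> {y}" unfolding \<F>_def by blast
    then show ?thesis by (rule countable_subset) simp
  qed
  ultimately show ?thesis using F(2) by (meson countable_UN countable_subset)
qed

text \<open>
  An infinite descent would give polynomials \<open>h i\<close> that vanish on \<open>A (i + 1)\<close> but not on \<open>A i\<close>, and
  none of them could be in the ideal generated by its predecessors.
\<close>

lemma wf_vanishing: "wf {(B, A). vanishing A \<subset> vanishing (B :: (complex^'n::finite) set)}"
  unfolding wf_iff_no_infinite_down_chain
proof
  assume "\<exists>A. \<forall>i. (A (Suc i), A i) \<in> {(B, A). vanishing A \<subset> vanishing (B :: (complex^'n) set)}"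
  then obtain A :: "nat \<Rightarrow> (complex^'n) set" where A: "\<And>i. vanishing (A i) \<subset> vanishing (A (Suc i))" by auto
  then have "\<forall>i. \<exists>h. h \<in> vanishing (A (Suc i)) \<and> h \<notin> vanishing (A i)" by blast
  then obtain h where h: "\<And>i. h i \<in> vanishing (A (Suc i))" "\<And>i. h i \<notin> vanishing (A i)" by metis
  have "h i \<in> polyfun" for i using h(1) by (auto simp: vanishing_def)
  then obtain n where n: "h n \<in> ideal_gen polyfun (h ` {..<n})"
    using noetherian_sequence[OF subring_polyfun noetherian_polyfun, of h] by blast
  have "mono (\<lambda>i. vanishing (A i))" using A by (simp add: mono_iff_le_Suc psubset_imp_subset)
  then have "h i \<in> vanishing (A n)" if "i < n" for i
    using h(1)[of i] that monoD[of "\<lambda>i. vanishing (A i)" "Suc i" n] by auto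
  then have "ideal_gen polyfun (h ` {..<n}) \<subseteq> vanishing (A n)"
    by (intro ideal_gen_minimal ideal_of_vanishing) auto
  with n h(2) show False by blast
qed

text \<open>
  Noetherian induction: on the part of \<open>A\<close> where the adapted coordinates degenerate, an additional
  polynomial vanishes; on the rest \<open>f\<close> is locally constant, and so takes only countably many values.
\<close>

theorem countable_critical_values:
  fixes A :: "(complex^'n::finite) set"
  assumes f: "f \<in> polyfun" and "critical_on f A"
  shows "countable (f ` A)"
  using assms(2)
proof (induction A rule: wf_induct_rule[OF wf_vanishing])
  case (1 A)
  show ?case
  proof (cases "A = {}")
    case False
    obtain G :: "'n \<Rightarrow> complex^'n \<Rightarrow> complex" where G: "\<And>i. G i \<in> polyfun"
      "\<exists>q\<in>A. det (jac G q) \<noteq> 0"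
      "\<And>h k q. \<lbrakk>h \<in> vanishing A; G k \<notin> vanishing A; q \<in> A\<rbrakk> \<Longrightarrow> det (jac (G(k := h)) q) = 0"
      using adapted_coordinates[OF False] by metis
    define B where "B = {q \<in> A. det (jac G q) = 0}"
    have "B \<subseteq> A" by (auto simp: B_def)
    have "(\<lambda>q. det (jac G q)) \<in> vanishing B - vanishing A"
      using G(2) polyfun_det_jac[of G, OF G(1)] by (auto simp: vanishing_def B_def)
    then have "vanishing A \<subset> vanishing B" using vanishing_antimono[OF \<open>B \<subseteq> A\<close>] by blast
    then have "countable (f ` B)"
      using 1 critical_on_subset[OF _ \<open>B \<subseteq> A\<close>] by auto
    moreover have "countable (f ` (A - B))"
    proof (rule countable_image_if_locally_constant)
      fix p assume "p \<in> A - B"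
      then have "p \<in> A" "det (jac G p) \<noteq> 0" by (auto simp: B_def)
      from locally_constant[OF G(1,3) f \<open>critical_on f A\<close> this]
      show "\<exists>U. open U \<and> p \<in> U \<and> (\<forall>q\<in>U \<inter> (A - B). f q = f p)" by blast
    qed
    moreover have "f ` A \<subseteq> f ` B \<union> f ` (A - B)" by blast
    ultimately show ?thesis by (meson countable_Un countable_subset)
  qed simp
qed

section \<open>Rank and row space\<close>

text \<open>
  If each of the rows is a combination of \<open>r\<close> basis vectors, then the columns are
  combinations of the \<open>r\<close> vectors of coefficients.
\<close>

lemma dim_columns_le_rank:
  fixes A :: "'a::field^'n^'m"
  shows "vec.dim (columns A) \<le> rank A"
proof -
  obtain B where B: "B \<subseteq> rows A" "vec.independent B" "rows A \<subseteq> vec.span B" "card B = vec.dim (rows A)"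
    by (rule vec.basis_exists)
  have finB: "finite B" using vec.finiteI_independent[OF B(2)] .
  have "\<exists>c. row i A = (\<Sum>b\<in>B. c b *s b)" for i
  proof -
    have "row i A \<in> vec.span B" using B(3) by (auto simp: rows_def)
    then show ?thesis by (auto simp: vec.span_finite[OF finB])
  qed
  then obtain c where c: "\<And>i. row i A = (\<Sum>b\<in>B. c i b *s b)" by metis
  let ?W = "(\<lambda>b. \<chi> i. c i b) ` B"
  have "column j A \<in> vec.span ?W" for j
  proof -
    have "column j A $ i = (\<Sum>b\<in>B. c i b * b $ j)" for i
      using arg_cong[OF c[of i], of "\<lambda>r. r $ j"] by (simp add: column_def row_def sum_component)
    then have "column j A = (\<Sum>b\<in>B. b $ j *s (\<chi> i. c i b))"
      by (simp add: vec_eq_iff sum_component mult.commute)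
    then show ?thesis by (simp only:) (intro vec.span_sum vec.span_scale vec.span_base imageI)
  qed
  then have "columns A \<subseteq> vec.span ?W" by (auto simp: columns_def)
  then have "vec.dim (columns A) \<le> card ?W" using finB by (intro vec.dim_le_card) auto
  also have "\<dots> \<le> card B" by (rule card_image_le[OF finB])
  finally show ?thesis using B(4) by (simp add: row_rank_def_gen)
qed

text \<open>
  The columns of the augmented matrix are \<open>v\<close> and the rows of \<open>M\<close>; if adding \<open>v\<close> to the rows of \<open>M\<close>
  does not raise the dimension, then \<open>v\<close> is in their span.
\<close>

lemma in_row_space_if_rank_prepend_col_le:
  fixes M :: "complex^'n^'m"
  assumes "rank (prepend_col v (transpose M)) \<le> rank M"
  shows "v \<in> vec.span (rows M)"
proof -
  let ?P = "prepend_col v (transpose M)"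
  have "column None ?P = v" "column (Some l) ?P = row l M" for l
    by (auto simp: column_def prepend_col_def row_def transpose_def vec_eq_iff)
  then have "columns ?P = insert v (rows M)"
    unfolding columns_def rows_def by (auto simp: split_option_ex)
  then have "vec.dim (insert v (rows M)) \<le> vec.dim (rows M)"
    using dim_columns_le_rank[of ?P] assms by (simp add: row_rank_def_gen)
  then have "vec.span (rows M) = vec.span (insert v (rows M))"
    by (intro vec.subspace_dim_equal) (auto intro: vec.span_mono[THEN subsetD])
  then show ?thesis using vec.span_base[of v "insert v (rows M)"] by simp
qed

lemma row_space_orthogonal_kernel:
  fixes M :: "complex^'n^'m"
  assumes "v \<in> vec.span (rows M)" and ker: "\<And>l. (\<Sum>j\<in>UNIV. M $ l $ j * w $ j) = 0"
  shows "(\<Sum>j\<in>UNIV. v $ j * w $ j) = 0"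
  using assms(1)
proof (induction rule: vec.span_induct_alt)
  case (step c x y)
  then obtain l where "x = row l M" by (auto simp: rows_def)
  then have "(\<Sum>j\<in>UNIV. x $ j * w $ j) = 0" using ker[of l] by (simp add: row_def)
  moreover have "(\<Sum>j\<in>UNIV. (c *s x + y) $ j * w $ j)
      = c * (\<Sum>j\<in>UNIV. x $ j * w $ j) + (\<Sum>j\<in>UNIV. y $ j * w $ j)"
    by (simp add: algebra_simps sum.distrib sum_distrib_left)
  ultimately show ?case using step by simp
qed simp

section \<open>The bottleneck correspondence as a set of critical points\<close>

lemma differential_eqI:
  assumes "h \<in> polyfun" "(h has_derivative h') (at q)"
  shows "differential h q v = h' v"
  using has_derivative_unique[OF polyfun_derivative(2)[OF assms(1)] assms(2)] by (simp add: differential_def fun_eq_iff)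

lemma coordinate_has_derivative: "((\<lambda>q. q $ i) has_derivative (\<lambda>v. v $ i)) F"
  by (rule bounded_linear_imp_has_derivative) (rule bounded_linear_vec_nth)

lemma peval_polyfun: "peval p \<in> polyfun"
  unfolding peval_def[abs_def] by (intro polyfun_sum polyfun.mult polyfun.const polyfun_prod polyfun_power polyfun.coord)

lemma polyfun_compose:
  assumes "h \<in> polyfun" "\<And>i. (\<lambda>q. g q $ i) \<in> polyfun"
  shows "(\<lambda>q. h (g q)) \<in> polyfun"
  using assms(1) by induction (auto intro: polyfun.intros assms(2))

text \<open>
  This connects the complex derivatives in the single variables with the real Frechet derivative.
\<close>

lemma jacobian_matrix_partial_deriv: "jacobian_matrix F p $ l $ j = partial_deriv j (peval (F l)) p"
proof -
  define \<phi> where "\<phi> w = (\<chi> i. if i = j then w else p $ i)" for w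
  have \<phi>p: "\<phi> (p $ j) = p" by (simp add: \<phi>_def vec_eq_iff)
  have "(\<phi> has_derivative (\<lambda>h. axis j h)) (at (p $ j))"
  proof -
    have "((\<lambda>w. \<phi> w $ i) has_derivative (\<lambda>h. axis j h $ i)) (at (p $ j))" for i
      by (cases "i = j") (auto simp: \<phi>_def axis_def)
    then show ?thesis
      by (subst has_derivative_componentwise_within) (auto simp: Basis_vec_def inner_axis intro: has_derivative_inner_left)
  qed
  from has_derivative_compose[OF this polyfun_derivative(2)[OF peval_polyfun]]
  have "((\<lambda>w. peval (F l) (\<phi> w)) has_derivative (\<lambda>h. partial_deriv j (peval (F l)) p * h)) (at (p $ j))"
    by (simp add: \<phi>p axis_def if_distrib[of "\<lambda>x. _ * x"] cong: if_cong)
  then have "((\<lambda>w. peval (F l) (\<phi> w)) has_field_derivative partial_deriv j (peval (F l)) p) (at (p $ j))"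
    by (simp add: has_field_derivative_def)
  from DERIV_imp_deriv[OF this] show ?thesis by (simp add: jacobian_matrix_def \<phi>_def)
qed

text \<open>
  The Sard theorem lives on \<open>complex^'N\<close> for a single index type, so a tuple of points with its
  weights is stored as one vector, indexed by a disjoint sum.
\<close>

definition flatten :: "((complex^'n)^'k) \<times> (complex^'k) \<Rightarrow> complex^('k::finite \<times> 'n::finite + 'k)" where
  "flatten b = (\<chi> s. case s of Inl (i, j) \<Rightarrow> fst b $ i $ j | Inr i \<Rightarrow> snd b $ i)"

lemma flatten_simps [simp]: "flatten (x, t) $ Inl (i, j) = x $ i $ j" "flatten (x, t) $ Inr i = t $ i"
  by (simp_all add: flatten_def)

lemma continuous_flatten: "continuous_on S flatten"
  unfolding flatten_def[abs_def]
proof (rule continuous_on_vec_lambda)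
  fix s :: "'b \<times> 'a + 'b"
  show "continuous_on S (\<lambda>b. case s of Inl (i, j) \<Rightarrow> fst b $ i $ j | Inr i \<Rightarrow> snd b $ i)"
    by (cases s) (auto intro!: continuous_intros split: prod.splits)
qed

text \<open>
  In flattened coordinates this is \<open>\<Sum>\<^sub>i t\<^sub>i d(x\<^sub>i, z)\<^sup>2\<close> with \<open>z = \<Sum>\<^sub>a t\<^sub>a x\<^sub>a\<close>, a polynomial that agrees
  with \<open>D\<close> on the bottleneck correspondence but, unlike \<open>D\<close>, weights the terms so that the
  contribution of \<open>dz\<close> to the differential cancels.
\<close>

definition weighted_sqdist :: "complex^('k::finite \<times> 'n::finite + 'k) \<Rightarrow> complex" where
  "weighted_sqdist q = (\<Sum>i\<in>UNIV. q $ Inr i *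
     (\<Sum>j\<in>UNIV. (q $ Inl (i, j) - (\<Sum>a\<in>UNIV. q $ Inr a * q $ Inl (a, j)))\<^sup>2))"

lemma weighted_sqdist_polyfun: "weighted_sqdist \<in> polyfun"
  unfolding weighted_sqdist_def[abs_def]
  by (intro polyfun_sum polyfun.mult polyfun_power polyfun_diff polyfun.coord)

lemma weighted_sqdist_flatten:
  "weighted_sqdist (flatten (x, t)) = (\<Sum>i\<in>UNIV. t $ i * sqdist (x $ i) (rho x t))"
  by (simp add: weighted_sqdist_def sqdist_def rho_def sum_component)

lemma differential_weighted_sqdist:
  "differential weighted_sqdist q v = (\<Sum>i\<in>UNIV. v $ Inr i *
       (\<Sum>j\<in>UNIV. (q $ Inl (i, j) - (\<Sum>a\<in>UNIV. q $ Inr a * q $ Inl (a, j)))\<^sup>2) +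
     q $ Inr i * (\<Sum>j\<in>UNIV. 2 * (q $ Inl (i, j) - (\<Sum>a\<in>UNIV. q $ Inr a * q $ Inl (a, j))) *
       (v $ Inl (i, j) - (\<Sum>a\<in>UNIV. v $ Inr a * q $ Inl (a, j) + q $ Inr a * v $ Inl (a, j)))))"
proof (rule differential_eqI[OF weighted_sqdist_polyfun])
  define Z where "Z j q = (\<Sum>a\<in>UNIV. q $ Inr a * q $ Inl (a, j))"
    for j and q :: "complex^('a \<times> 'b + 'a)"
  define dZ where "dZ j v = (\<Sum>a\<in>UNIV. v $ Inr a * q $ Inl (a, j) + q $ Inr a * v $ Inl (a, j))" for j v
  have Z: "(Z j has_derivative dZ j) (at q)" for j
    unfolding Z_def[abs_def] dZ_def[abs_def]
  proof (rule has_derivative_sum)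
    fix a
    show "((\<lambda>q. q $ Inr a * q $ Inl (a, j)) has_derivative
        (\<lambda>v. v $ Inr a * q $ Inl (a, j) + q $ Inr a * v $ Inl (a, j))) (at q)"
      by (rule has_derivative_eq_rhs[OF has_derivative_mult[OF coordinate_has_derivative coordinate_has_derivative]])
        (simp add: add.commute)
  qed
  have sq: "((\<lambda>q. (q $ Inl (i, j) - Z j q)\<^sup>2) has_derivative
      (\<lambda>v. 2 * (q $ Inl (i, j) - Z j q) * (v $ Inl (i, j) - dZ j v))) (at q)" for i j
    by (rule has_derivative_eq_rhs[OF has_derivative_power[OF has_derivative_diff[OF coordinate_has_derivative Z]]])
      (auto simp: algebra_simps)
  have sq_sum: "((\<lambda>q. \<Sum>j\<in>UNIV. (q $ Inl (i, j) - Z j q)\<^sup>2) has_derivative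
      (\<lambda>v. \<Sum>j\<in>UNIV. 2 * (q $ Inl (i, j) - Z j q) * (v $ Inl (i, j) - dZ j v))) (at q)" for i
    by (rule has_derivative_sum) (rule sq)
  have "((\<lambda>q. \<Sum>i\<in>UNIV. q $ Inr i * (\<Sum>j\<in>UNIV. (q $ Inl (i, j) - Z j q)\<^sup>2)) has_derivative
      (\<lambda>v. \<Sum>i\<in>UNIV. v $ Inr i * (\<Sum>j\<in>UNIV. (q $ Inl (i, j) - Z j q)\<^sup>2) +
        q $ Inr i * (\<Sum>j\<in>UNIV. 2 * (q $ Inl (i, j) - Z j q) * (v $ Inl (i, j) - dZ j v)))) (at q)"
  proof (rule has_derivative_sum)
    fix i
    show "((\<lambda>q. q $ Inr i * (\<Sum>j\<in>UNIV. (q $ Inl (i, j) - Z j q)\<^sup>2)) has_derivative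
      (\<lambda>v. v $ Inr i * (\<Sum>j\<in>UNIV. (q $ Inl (i, j) - Z j q)\<^sup>2) +
        q $ Inr i * (\<Sum>j\<in>UNIV. 2 * (q $ Inl (i, j) - Z j q) * (v $ Inl (i, j) - dZ j v)))) (at q)"
      by (rule has_derivative_eq_rhs[OF has_derivative_mult[OF coordinate_has_derivative sq_sum]])
        (simp only: add.commute)
  qed
  then show "(weighted_sqdist has_derivative (\<lambda>v. \<Sum>i\<in>UNIV. v $ Inr i *
       (\<Sum>j\<in>UNIV. (q $ Inl (i, j) - (\<Sum>a\<in>UNIV. q $ Inr a * q $ Inl (a, j)))\<^sup>2) +
     q $ Inr i * (\<Sum>j\<in>UNIV. 2 * (q $ Inl (i, j) - (\<Sum>a\<in>UNIV. q $ Inr a * q $ Inl (a, j))) *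
       (v $ Inl (i, j) - (\<Sum>a\<in>UNIV. v $ Inr a * q $ Inl (a, j) + q $ Inr a * v $ Inl (a, j)))))) (at q)"
    unfolding weighted_sqdist_def[abs_def] Z_def dZ_def .
qed

lemma D_eq_weighted_sqdist:
  assumes "b \<in> bottleneck F c"
  shows "D b = weighted_sqdist (flatten b)"
proof -
  obtain x t where b: "b = (x, t)" by (cases b)
  have "\<forall>i j. sqdist (x $ i) (rho x t) = sqdist (x $ j) (rho x t)"
    using assms unfolding b bottleneck_def by blast
  then obtain r where eq: "\<And>i. sqdist (x $ i) (rho x t) = r" by blast
  have "(\<Sum>i\<in>UNIV. t $ i) = 1" using assms by (auto simp: b bottleneck_def)
  then have "weighted_sqdist (flatten b) = r"
    unfolding b weighted_sqdist_flatten eq by (simp flip: sum_distrib_right)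
  moreover have "D b = r" by (simp add: b D_def eq)
  ultimately show ?thesis by simp
qed

text \<open>
  The polynomials \<open>\<Sum>\<^sub>i t\<^sub>i - 1\<close> and \<open>f\<^sub>l(x\<^sub>i)\<close> vanish on the correspondence, so a direction \<open>v\<close> killed by
  the ideal has weight components summing to zero and point components \<open>w i\<close> in the kernels of the
  Jacobians. By the rank condition \<open>x\<^sub>i - z\<close> is orthogonal to \<open>w i\<close>, and every term of the
  differential vanishes.
\<close>

lemma weighted_sqdist_critical:
  fixes F :: "'m::finite \<Rightarrow> 'n::finite cpoly"
  assumes smooth: "smooth_of_codim F c"
  shows "critical_on weighted_sqdist (flatten ` (bottleneck F c :: (((complex^'n)^'k::finite) \<times> (complex^'k)) set))"
    (is "critical_on _ ?A")
  unfolding critical_on_def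
proof (intro ballI allI impI)
  fix q v assume "q \<in> ?A" and v: "\<forall>h\<in>vanishing ?A. differential h q v = 0"
  then obtain x :: "(complex^'n)^'k" and t where xt: "(x, t) \<in> bottleneck F c" and q: "q = flatten (x, t)" by auto
  define z where "z = rho x t"
  have t1: "(\<Sum>i\<in>UNIV. t $ i) = 1" and "\<forall>i j. sqdist (x $ i) z = sqdist (x $ j) z"
    and zero: "\<And>i. x $ i \<in> zero_set (range F)"
    and rk: "\<And>i. rank (prepend_col (x $ i - z) (transpose (jacobian_matrix F (x $ i)))) \<le> c"
    using xt unfolding bottleneck_def z_def by blast+
  then obtain r where dist: "\<And>i. sqdist (x $ i) z = r" by blast
  have z: "z $ j = (\<Sum>a\<in>UNIV. t $ a * x $ a $ j)" for j by (simp add: z_def rho_def sum_component)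
  define w where "w i = (\<chi> j. v $ Inl (i, j))" for i
  \<comment> \<open>the derivative of \<open>z = \<Sum>\<^sub>a t\<^sub>a x\<^sub>a\<close> in the direction \<open>v\<close>\<close>
  define \<zeta> where "\<zeta> j = (\<Sum>a\<in>UNIV. v $ Inr a * x $ a $ j + t $ a * v $ Inl (a, j))" for j
  have sum_dt: "(\<Sum>i\<in>UNIV. v $ Inr i) = 0"
  proof -
    let ?h = "\<lambda>q :: complex^('k \<times> 'n + 'k). (\<Sum>i\<in>UNIV. q $ Inr i) - 1"
    have h: "?h \<in> polyfun" by (intro polyfun_diff polyfun_sum polyfun.const polyfun.coord)
    have "?h \<in> vanishing ?A" using h by (auto simp: vanishing_def bottleneck_def)
    moreover have "(?h has_derivative (\<lambda>v. \<Sum>i\<in>UNIV. v $ Inr i)) (at q)"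
      by (auto intro!: derivative_eq_intros coordinate_has_derivative)
    ultimately show ?thesis using v differential_eqI[OF h, of _ q v] by auto
  qed
  have ker: "(\<Sum>j\<in>UNIV. jacobian_matrix F (x $ i) $ l $ j * w i $ j) = 0" for i l
  proof -
    define pt where "pt q = (\<chi> j. q $ Inl (i, j))" for q :: "complex^('k \<times> 'n + 'k)"
    let ?h = "\<lambda>q. peval (F l) (pt q)"
    have h: "?h \<in> polyfun" by (rule polyfun_compose[OF peval_polyfun]) (simp add: pt_def polyfun.coord)
    have pt: "pt (flatten (y, s)) = y $ i" for y s by (simp add: pt_def vec_eq_iff)
    have "?h \<in> vanishing ?A" using h by (auto simp: vanishing_def bottleneck_def pt zero_set_def)
    moreover have "(pt has_derivative pt) (at q)"
    proof -
      have "((\<lambda>q. pt q $ j) has_derivative (\<lambda>v. pt v $ j)) (at q)" for j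
        by (simp add: pt_def coordinate_has_derivative)
      then show ?thesis
        by (subst has_derivative_componentwise_within) (auto simp: Basis_vec_def inner_axis intro: has_derivative_inner_left)
    qed
    from has_derivative_compose[OF this polyfun_derivative(2)[OF peval_polyfun]]
    have "(?h has_derivative (\<lambda>v. \<Sum>j\<in>UNIV. partial_deriv j (peval (F l)) (pt q) * pt v $ j)) (at q)" .
    ultimately have "(\<Sum>j\<in>UNIV. partial_deriv j (peval (F l)) (pt q) * pt v $ j) = 0"
      using v differential_eqI[OF h, of _ q v] by auto
    then show ?thesis by (simp add: jacobian_matrix_partial_deriv q pt w_def) (simp add: pt_def)
  qed
  have normal: "(\<Sum>j\<in>UNIV. (x $ i $ j - z $ j) * w i $ j) = 0" for i
  proof -
    have "rank (jacobian_matrix F (x $ i)) = c" using smooth zero by (simp add: smooth_of_codim_def)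
    then have "x $ i - z \<in> vec.span (rows (jacobian_matrix F (x $ i)))"
      using rk by (intro in_row_space_if_rank_prepend_col_le) simp
    from row_space_orthogonal_kernel[OF this ker[of i]] show ?thesis by simp
  qed
  have "differential weighted_sqdist q v = (\<Sum>i\<in>UNIV. v $ Inr i * sqdist (x $ i) z +
     t $ i * (\<Sum>j\<in>UNIV. 2 * (x $ i $ j - z $ j) * (w i $ j - \<zeta> j)))"
    unfolding differential_weighted_sqdist q by (simp add: sqdist_def z w_def \<zeta>_def)
  also have "\<dots> = (\<Sum>i\<in>UNIV. v $ Inr i * r + 2 * t $ i * (\<Sum>j\<in>UNIV. (x $ i $ j - z $ j) * w i $ j)
     - 2 * (\<Sum>j\<in>UNIV. t $ i * (x $ i $ j - z $ j) * \<zeta> j))"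
    unfolding dist
    by (simp add: algebra_simps sum.distrib sum_distrib_left sum_subtractf)
  also have "\<dots> = (\<Sum>i\<in>UNIV. v $ Inr i) * r
     - 2 * (\<Sum>i\<in>UNIV. \<Sum>j\<in>UNIV. t $ i * (x $ i $ j - z $ j) * \<zeta> j)"
    unfolding normal by (simp add: sum_subtractf sum_distrib_left sum_distrib_right)
  also have "(\<Sum>i\<in>UNIV. \<Sum>j\<in>UNIV. t $ i * (x $ i $ j - z $ j) * \<zeta> j)
     = (\<Sum>j\<in>UNIV. (\<Sum>i\<in>UNIV. t $ i * (x $ i $ j - z $ j)) * \<zeta> j)"
    by (subst sum.swap) (simp add: sum_distrib_right)
  also have "\<dots> = 0"
  proof (intro sum.neutral ballI)
    fix j
    have "(\<Sum>i\<in>UNIV. t $ i * (x $ i $ j - z $ j)) = z $ j - (\<Sum>i\<in>UNIV. t $ i) * z $ j"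
      by (simp add: z right_diff_distrib sum_subtractf sum_distrib_right)
    then show "(\<Sum>i\<in>UNIV. t $ i * (x $ i $ j - z $ j)) * \<zeta> j = 0" by (simp add: t1)
  qed
  finally show "differential weighted_sqdist q v = 0" by (simp add: sum_dt)
qed

theorem theorem4p8:
  fixes F :: "'m::finite \<Rightarrow> 'n::finite cpoly" and c :: nat
    and C :: "(((complex^'n)^'k::finite) \<times> (complex^'k)) set"
  assumes "\<And>l. real_coeffs (F l)"
    and "smooth_of_codim F c"
    and "equidimensional_codim (zero_set (range F)) c"
    and "CARD('k) \<ge> 2"
    and "C \<in> components (bottleneck F c - Gam)"
  shows "D constant_on C"
proof -
  have sub: "C \<subseteq> bottleneck F c" using in_components_subset[OF assms(5)] by blast
  define S where "S = weighted_sqdist ` flatten ` C"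
  have "countable (weighted_sqdist ` flatten ` (bottleneck F c :: (((complex^'n)^'k) \<times> (complex^'k)) set))"
    by (rule countable_critical_values[OF weighted_sqdist_polyfun weighted_sqdist_critical[OF assms(2)]])
  then have "countable S" by (rule countable_subset[rotated]) (use sub in \<open>auto simp: S_def\<close>)
  moreover have "connected S"
    unfolding S_def using in_components_connected[OF assms(5)]
    by (intro connected_continuous_image polyfun_continuous_on weighted_sqdist_polyfun continuous_flatten)
  ultimately have "a = b" if "a \<in> S" "b \<in> S" for a b
    using connected_uncountable that by blast
  then have "D a = D b" if "a \<in> C" "b \<in> C" for a b
    using that sub D_eq_weighted_sqdist[of a F c] D_eq_weighted_sqdist[of b F c] by (auto simp: S_def)
  then show ?thesis unfolding constant_on_def by metis
qed

end
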